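(* Let $w=(w_k)_{k\ge0}$ be a weight sequence and suppose that for some $c>0$ and $\alpha$ with $1<\alpha\le2$, $w_k\sim ck^{-\alpha-1}$ as $k\to\infty$. (i) If $\nu=1$, then $$Z_n\sim\frac{\Phi(1)^{1/\alpha}}{c^{1/\alpha}\Gamma(-\alpha)^{1/\alpha}|\Gamma(-1/\alpha)|}\Phi(1)^nn^{-1-1/\alpha}\quad\text{when }1<\alpha<2,$$ and $$Z_n\sim\Big(\frac{\Phi(1)}{\pi c}\Big)^{1/2}\Phi(1)^nn^{-3/2}(\log n)^{-1/2}\quad\text{when }\alpha=2.$$ (ii) If $m=\nu n+o(n^{1/\alpha})$, then $$Z(m,n)\sim\frac{\Phi(1)^{1/\alpha}}{c^{1/\alpha}\Gamma(-\alpha)^{1/\alpha}|\Gamma(-1/\alpha)|}\Phi(1)^nn^{-1/\alpha}\quad\text{when }1<\alpha<2,$$ and $$Z(m,n)\sim\Big(\frac{\Phi(1)}{\pi c}\Big)^{1/2}\frac{\Phi(1)^n}{\sqrt{n\log n}}\quad\text{when }\alpha=2.$$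
   Context: A weight sequence is a sequence $w=(w_k)_{k\ge0}$ of nonnegative reals. $\Phi(t)=\sum_kw_kt^k$ (here the radius of convergence is $\rho=1$ and $\Phi(1)<\infty$); $\nu=\Psi(1)=\Phi'(1)/\Phi(1)$. $Z_n=\sum_T\prod_{v\in T}w_{d^+_T(v)}$ over all ordered rooted trees $T$ with $n$ nodes ($d^+_T(v)$ the number of children of $v$); $Z(m,n)=\sum\prod_{i=1}^nw_{y_i}$ over all $(y_1,\dots,y_n)\in\{0,1,\dots\}^n$ with $\sum y_i=m$. $\Gamma$ is the Gamma function. *)

theory Defs
  imports "HOL-Analysis.Analysis" "HOL-Library.Landau_Symbols"
begin

datatype ptree = PNode "ptree list"

fun tsize :: "ptree \<Rightarrow> nat" where
  "tsize (PNode ts) = Suc (sum_list (map tsize ts))"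

fun tweight :: "(nat \<Rightarrow> real) \<Rightarrow> ptree \<Rightarrow> real" where
  "tweight w (PNode ts) = w (length ts) * prod_list (map (tweight w) ts)"

definition Ztree :: "(nat \<Rightarrow> real) \<Rightarrow> nat \<Rightarrow> real" where
  "Ztree w n = (\<Sum>T\<in>{T. tsize T = n}. tweight w T)"

definition Zmn :: "(nat \<Rightarrow> real) \<Rightarrow> nat \<Rightarrow> nat \<Rightarrow> real" where
  "Zmn w m n = (\<Sum>ys\<in>{ys. length ys = n \<and> sum_list ys = m}. prod_list (map w ys))"

definition Phi :: "(nat \<Rightarrow> real) \<Rightarrow> real \<Rightarrow> real" where
  "Phi w t = (\<Sum>k. w k * t ^ k)"

text \<open>nu = Psi(1) = Phi'(1)/Phi(1), with Phi'(1) = sum_k k w_k.\<close>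
definition nu :: "(nat \<Rightarrow> real) \<Rightarrow> real" where
  "nu w = (\<Sum>k. real k * w k) / Phi w 1"

end

theory Submission
  imports Defs "HOL-Real_Asymp.Real_Asymp"
begin

text \<open>Removing the root of the first tree of a forest gives a recursion for forest weights that is
  solved by \<open>(k/n) Z(n-k, n)\<close>, so \<open>Z\<^sub>n = Z(n-1, n) / n\<close> and only \<open>Z(m, n)\<close> matters. By Fourier
  inversion it is the integral of \<open>e\<^sup>-\<^sup>i\<^sup>m\<^sup>t \<Phi>(e\<^sup>i\<^sup>t)\<^sup>n\<close>. The behaviour of \<open>\<Phi>(e\<^sup>i\<^sup>t)\<close> at \<open>t = 0\<close> is read off by
  comparing \<open>w\<close> with the coefficients of \<open>(1-z)\<^sup>\<alpha>\<close>, respectively of \<open>-(1-z)\<^sup>2 log (1-z)\<close> when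
  \<open>\<alpha> = 2\<close>, which have the same decay up to a constant factor. Rescaling \<open>t\<close> by \<open>n\<close> to the
  power \<open>1/\<alpha>\<close>, respectively by
  \<open>(n log n)\<close> to the power \<open>1/2\<close>, and dominated convergence leave the integral of
  \<open>exp (-\<zeta> s\<^sup>\<alpha>)\<close> over the half-line, a Gamma value.\<close>

section \<open>Trees, forests and convolution powers\<close>

text \<open>Only the leading order of \<open>w\<close> is given, while Fourier inversion needs
  Phi(e^(it)) beyond its constant and linear terms. If a_k are the comparison coefficients, the
  error w_k - C a_k is merely o(a_k), and it multiplies the oscillating remainder e^(ikt) - 1 - ikt.
  That remainder is at most a constant times the nonnegative e^(-kt) - 1 + kt, and summing a_k
  against the latter gives the comparison function itself at e^(-t), known in closed form. So one
  explicit function yields the main term on the circle and the error bound on the real axis. The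
  coefficients of (1-z)^\<alpha> are asymptotic to k^(-\<alpha>-1) / Gamma(-\<alpha>), which is the
  origin of the factor c Gamma(-\<alpha>); for \<alpha> = 2 they vanish for k > 2, which forces the
  logarithm. Gamma(-1/\<alpha>) enters through the reflection formula. Away from t = 0 the integrand
  is exponentially small because the weights are eventually positive, so that two consecutive ones
  are.\<close>

lemma finite_nat_lists_sum: "finite {ys :: nat list. length ys = n \<and> sum_list ys = m}"
proof (rule finite_subset)
  show "{ys :: nat list. length ys = n \<and> sum_list ys = m} \<subseteq> {ys. set ys \<subseteq> {..m} \<and> length ys = n}"
    by (auto dest: member_le_sum_list)
  show "finite {ys. set ys \<subseteq> {..m} \<and> length ys = n}"
    by (rule finite_lists_length_eq) auto
qed

lemma Zmn_0: "Zmn w m 0 = (if m = 0 then 1 else 0)"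
proof -
  have "{ys :: nat list. length ys = 0 \<and> sum_list ys = m} = (if m = 0 then {[]} else {})"
    by auto
  thus ?thesis unfolding Zmn_def by simp
qed

lemma Zmn_Suc: "Zmn w m (Suc n) = (\<Sum>i\<le>m. w i * Zmn w (m - i) n)"
proof -
  let ?B = "\<lambda>i. {ys :: nat list. length ys = n \<and> sum_list ys = m - i}"
  have "(\<Sum>i\<le>m. w i * Zmn w (m - i) n) = (\<Sum>i\<le>m. \<Sum>ys\<in>?B i. w i * prod_list (map w ys))"
    by (simp add: Zmn_def sum_distrib_left)
  also have "\<dots> = (\<Sum>(i, ys)\<in>(SIGMA i:{..m}. ?B i). w i * prod_list (map w ys))"
    by (rule sum.Sigma) (auto intro: finite_nat_lists_sum)
  also have "\<dots> = Zmn w m (Suc n)"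
    unfolding Zmn_def
    by (rule sum.reindex_bij_witness[where i = "\<lambda>ys. (hd ys, tl ys)" and j = "\<lambda>(i, ys). i # ys"])
       (auto simp: length_Suc_conv)
  finally show ?thesis by simp
qed

lemma Zmn_eq_fps_nth_power: "Zmn w m n = fps_nth (Abs_fps w ^ n) m"
proof (induction n arbitrary: m)
  case 0
  show ?case by (simp add: Zmn_0)
next
  case (Suc n)
  show ?case by (simp add: Zmn_Suc Suc fps_mult_nth atMost_atLeast0)
qed

text \<open>Compare coefficients in \<open>(W\<^sup>N)' = N W' W\<^sup>N\<^sup>-\<^sup>1\<close>.\<close>
lemma sum_index_Zmn:
  "real (Suc n) * (\<Sum>j\<le>m. real j * w j * Zmn w (m - j) n) = real m * Zmn w m (Suc n)"
proof (cases m)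
  case 0
  thus ?thesis by simp
next
  case (Suc k)
  have *: "real (Suc k) * Zmn w (Suc k) (Suc n) =
      fps_nth (fps_deriv (Abs_fps w ^ Suc n)) k"
    by (simp add: Zmn_eq_fps_nth_power del: power_Suc)
  also have "\<dots> = real (Suc n) * fps_nth (fps_deriv (Abs_fps w) * Abs_fps w ^ n) k"
    by (subst fps_deriv_power) (simp add: mult.assoc fps_of_nat [symmetric] fps_mult_left_const_nth del: fps_const_add of_nat_Suc)
  also have "fps_nth (fps_deriv (Abs_fps w) * Abs_fps w ^ n) k =
      (\<Sum>j\<le>k. real (Suc j) * w (Suc j) * Zmn w (k - j) n)"
    by (simp add: fps_mult_nth Zmn_eq_fps_nth_power atMost_atLeast0)
  \<comment> \<open>The added term \<open>j = 0\<close> vanishes through its factor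
    \<open>j\<close>.\<close>
  also have "\<dots> = (\<Sum>j\<le>Suc k. real j * w j * Zmn w (Suc k - j) n)"
    by (subst sum.atMost_Suc_shift) simp
  finally show ?thesis using Suc by simp
qed

section \<open>Forests and the root-removal recursion\<close>

definition forests :: "nat \<Rightarrow> nat \<Rightarrow> ptree list set" where
  "forests k n = {ts. length ts = k \<and> sum_list (map tsize ts) = n}"

definition Zforest :: "(nat \<Rightarrow> real) \<Rightarrow> nat \<Rightarrow> nat \<Rightarrow> real" where
  "Zforest w k n = (\<Sum>ts\<in>forests k n. prod_list (map (tweight w) ts))"

lemma tsize_pos: "tsize t > 0"
  by (cases t) auto

lemma length_le_sum_tsize: "length ts \<le> sum_list (map tsize ts)"
proof (induction ts)
  case (Cons t ts)
  thus ?case using tsize_pos[of t] by simp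
qed simp

lemma forests_empty: "k > n \<Longrightarrow> forests k n = {}"
  using length_le_sum_tsize by (auto simp: forests_def linorder_not_le [symmetric])

lemma forests_0: "forests 0 n = (if n = 0 then {[]} else {})"
  by (auto simp: forests_def)

text \<open>The children of the deleted root join the remaining \<open>k\<close> trees in one list.
  The pair records the root degree \<open>j\<close>, without which the joined list would not tell
  where to cut; \<open>j \<le> n\<close> because every child subtree has a node.\<close>

lemma forests_Suc_Suc:
  "forests (Suc k) (Suc n) =
     (\<lambda>(j, ts). PNode (take j ts) # drop j ts) ` (SIGMA j:{..n}. forests (k + j) n)"
proof (intro equalityI subsetI)
  fix ts assume "ts \<in> forests (Suc k) (Suc n)"
  then obtain us vs where ts: "ts = PNode us # vs" "length vs = k"
    "sum_list (map tsize us) + sum_list (map tsize vs) = n"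
    by (auto simp: forests_def length_Suc_conv) (metis ptree.exhaust tsize.simps add_Suc nat.inject)
  have "length us \<le> n"
    using length_le_sum_tsize[of us] ts by simp
  hence "(length us, us @ vs) \<in> (SIGMA j:{..n}. forests (k + j) n)"
    using ts by (auto simp: forests_def)
  thus "ts \<in> (\<lambda>(j, ts). PNode (take j ts) # drop j ts) ` (SIGMA j:{..n}. forests (k + j) n)"
    by (rule rev_image_eqI) (simp add: ts)
next
  fix ts assume "ts \<in> (\<lambda>(j, ts). PNode (take j ts) # drop j ts) ` (SIGMA j:{..n}. forests (k + j) n)"
  then obtain j us where us: "us \<in> forests (k + j) n" "ts = PNode (take j us) # drop j us"
    by auto
  have "sum_list (map tsize (take j us)) + sum_list (map tsize (drop j us)) =
        sum_list (map tsize (take j us @ drop j us))"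
    by (simp only: map_append sum_list_append)
  thus "ts \<in> forests (Suc k) (Suc n)"
    using us by (simp add: forests_def)
qed

text \<open>The list is recovered by appending the two pieces, and its length \<open>k + j\<close>
  then determines \<open>j\<close>.\<close>

lemma inj_on_graft:
  "inj_on (\<lambda>(j, ts). PNode (take j ts) # drop j ts) (SIGMA j:{..n}. forests (k + j) n)"
proof (rule inj_onI, clarify)
  fix j ts j' ts'
  assume *: "ts \<in> forests (k + j) n" "ts' \<in> forests (k + j') n"
    "take j ts = take j' ts'" "drop j ts = drop j' ts'"
  have "ts = ts'"
    using *(3,4) by (metis append_take_drop_id)
  thus "j = j' \<and> ts = ts'"
    using * by (auto simp: forests_def)
qed

text \<open>Root removal lowers \<open>n\<close> but may raise the number of trees, so the induction
  on \<open>n\<close> is for all \<open>k\<close> at once.\<close>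

lemma finite_forests: "finite (forests k n)"
proof (induction n arbitrary: k)
  case 0
  thus ?case by (cases k) (simp_all add: forests_0 forests_empty)
next
  case (Suc n)
  thus ?case by (cases k) (auto simp: forests_0 forests_Suc_Suc)
qed

lemma Zforest_Suc_Suc: "Zforest w (Suc k) (Suc n) = (\<Sum>j\<le>n. w j * Zforest w (k + j) n)"
proof -
  have "Zforest w (Suc k) (Suc n) = (\<Sum>(j, ts)\<in>(SIGMA j:{..n}. forests (k + j) n).
      tweight w (PNode (take j ts)) * prod_list (map (tweight w) (drop j ts)))"
    unfolding Zforest_def forests_Suc_Suc
    by (subst sum.reindex[OF inj_on_graft]) (simp add: case_prod_unfold)
  also have "\<dots> = (\<Sum>(j, ts)\<in>(SIGMA j:{..n}. forests (k + j) n).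
      w j * prod_list (map (tweight w) ts))"
  proof (intro sum.cong refl, clarify)
    fix j ts assume "ts \<in> forests (k + j) n"
    hence "length (take j ts) = j" by (simp add: forests_def)
    moreover have "prod_list (map (tweight w) ts) =
        prod_list (map (tweight w) (take j ts)) * prod_list (map (tweight w) (drop j ts))"
      by (metis append_take_drop_id map_append prod_list.append)
    ultimately show "tweight w (PNode (take j ts)) * prod_list (map (tweight w) (drop j ts)) =
        w j * prod_list (map (tweight w) ts)"
      by (simp add: mult.assoc)
  qed
  also have "\<dots> = (\<Sum>j\<le>n. w j * Zforest w (k + j) n)"
    by (subst sum.Sigma [symmetric]) (auto simp: finite_forests Zforest_def sum_distrib_left)
  finally show ?thesis .
qed

text \<open>The Otter-Dwass formula, here by algebra instead of cyclic shifts. With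
  \<open>k = l + 1\<close>, the induction hypothesis supplies a factor \<open>l + j\<close> in the
  recursion: its \<open>l\<close> part sums by \<open>Zmn_Suc\<close>, its \<open>j\<close> part by
  \<open>sum_index_Zmn\<close>. Trees are the case \<open>k = 1\<close>, but root removal leads to
  every \<open>k\<close>.\<close>

lemma Zforest_eq_Zmn:
  assumes "k \<le> n"
  shows "real n * Zforest w k n = real k * Zmn w (n - k) n"
  using assms
proof (induction n arbitrary: k)
  case 0
  thus ?case by simp
next
  case (Suc n)
  show ?case
  proof (cases k)
    case 0
    thus ?thesis by (simp add: Zforest_def forests_0)
  next
    case (Suc l)
    hence l: "l \<le> n" using Suc.prems by simp
    have F: "Zforest w k (Suc n) = (\<Sum>j\<le>n - l. w j * Zforest w (l + j) n)"
    proof -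
      \<comment> \<open>For \<open>j > n - l\<close> there are more trees than nodes. Dropping these
        terms keeps \<open>l + j \<le> n\<close>, as the induction hypothesis requires.\<close>
      have "(\<Sum>j\<le>n. w j * Zforest w (l + j) n) = (\<Sum>j\<le>n - l. w j * Zforest w (l + j) n)"
        by (rule sum.mono_neutral_right) (auto simp: Zforest_def forests_empty)
      thus ?thesis by (simp add: Suc Zforest_Suc_Suc)
    qed
    show ?thesis
    \<comment> \<open>The main argument proves the claim multiplied by \<open>n\<close>, which is
      cancelled at the end; hence \<open>n = 0\<close> is separate.\<close>
    proof (cases "n = 0")
      case True
      thus ?thesis using l F Suc by (simp add: Zforest_def forests_0 Zmn_Suc Zmn_0)
    next
      case False
      have "real n * Zforest w k (Suc n) = (\<Sum>j\<le>n - l. w j * (real n * Zforest w (l + j) n))"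
        by (simp add: F sum_distrib_left mult_ac)
      also have "\<dots> = (\<Sum>j\<le>n - l. w j * (real (l + j) * Zmn w (n - l - j) n))"
        using l by (intro sum.cong refl) (simp add: Suc.IH)
      also have "\<dots> = real l * (\<Sum>j\<le>n - l. w j * Zmn w (n - l - j) n) +
          (\<Sum>j\<le>n - l. real j * w j * Zmn w (n - l - j) n)"
        by (simp add: sum_distrib_left sum.distrib [symmetric] algebra_simps)
      also have "(\<Sum>j\<le>n - l. w j * Zmn w (n - l - j) n) = Zmn w (n - l) (Suc n)"
        by (simp add: Zmn_Suc)
      finally have "real (Suc n) * (real n * Zforest w k (Suc n)) =
          real (Suc n) * real l * Zmn w (n - l) (Suc n) +
          real (Suc n) * (\<Sum>j\<le>n - l. real j * w j * Zmn w (n - l - j) n)"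
        by (simp add: algebra_simps)
      also have "\<dots> = real (Suc n) * real l * Zmn w (n - l) (Suc n) + real (n - l) * Zmn w (n - l) (Suc n)"
        by (simp only: sum_index_Zmn)
      \<comment> \<open>Here (n + 1) l + (n - l) = n (l + 1) and k = l + 1.\<close>
      also have "\<dots> = real n * (real k * Zmn w (n - l) (Suc n))"
        using l by (simp add: Suc of_nat_diff algebra_simps)
      finally have "real n * (real (Suc n) * Zforest w k (Suc n)) = real n * (real k * Zmn w (n - l) (Suc n))"
        by (simp only: mult_ac)
      thus ?thesis using False Suc by simp
    qed
  qed
qed

lemma Ztree_eq_Zmn:
  assumes "n > 0"
  shows "Ztree w n = Zmn w (n - 1) n / real n"
proof -
  have "Zforest w 1 n = Ztree w n"
    unfolding Ztree_def Zforest_def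
    by (rule sum.reindex_bij_witness[where i = "\<lambda>t. [t]" and j = hd])
       (auto simp: forests_def length_Suc_conv)
  thus ?thesis using Zforest_eq_Zmn[of 1 n w] assms by (simp add: field_simps)
qed

section \<open>Fourier inversion\<close>

text \<open>This is Phi(e^(it)), the generating function on the unit circle; for weights of total
  mass 1 it is a characteristic function.\<close>

definition chf :: "(nat \<Rightarrow> real) \<Rightarrow> real \<Rightarrow> complex" where
  "chf p t = (\<Sum>k. of_real (p k) * cis (real k * t))"

lemma Zmn_nonneg: "(\<And>k. w k \<ge> 0) \<Longrightarrow> Zmn w m n \<ge> 0"
  unfolding Zmn_def by (intro sum_nonneg prod_list_nonneg) auto

lemma summable_chf:
  assumes "\<And>k. w k \<ge> (0::real)" "summable w"
  shows "summable (\<lambda>k. norm (of_real (w k) * cis (real k * t)))"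
  using assms by (simp add: norm_mult)

lemma chf_sums:
  assumes "\<And>k. w k \<ge> (0::real)" "summable w"
  shows "(\<lambda>k. of_real (w k) * cis (real k * t)) sums chf w t"
  unfolding chf_def using summable_norm_cancel[OF summable_chf[OF assms]] by (rule summable_sums)

lemma summable_Zmn:
  assumes "\<And>k. w k \<ge> 0" "summable w"
  shows "summable (\<lambda>m. Zmn w m n)"
proof (induction n)
  case 0
  have "(\<lambda>m. Zmn w m 0) sums (\<Sum>m\<in>{0}. Zmn w m 0)"
    by (rule sums_finite) (auto simp: Zmn_0)
  thus ?case by (rule sums_summable)
next
  case (Suc n)
  show ?case unfolding Zmn_Suc
    by (rule summable_Cauchy_product) (use assms Suc in \<open>simp_all add: Zmn_nonneg\<close>)
qed

lemma chf_power_sums: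
  assumes "\<And>k. w k \<ge> 0" "summable w"
  shows "(\<lambda>m. of_real (Zmn w m n) * cis (real m * t)) sums (chf w t ^ n)"
proof (induction n)
  case 0
  have "(\<lambda>m. of_real (Zmn w m 0) * cis (real m * t)) sums
      (\<Sum>m\<in>{0}. of_real (Zmn w m 0) * cis (real m * t))"
    by (rule sums_finite) (auto simp: Zmn_0)
  thus ?case by (simp add: Zmn_0)
next
  case (Suc n)
  have "(\<lambda>m. \<Sum>i\<le>m. (of_real (w i) * cis (real i * t)) * (of_real (Zmn w (m - i) n) * cis (real (m - i) * t)))
      sums ((\<Sum>i. of_real (w i) * cis (real i * t)) * (\<Sum>i. of_real (Zmn w i n) * cis (real i * t)))"
    by (intro Cauchy_product_sums summable_chf assms summable_Zmn Zmn_nonneg)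
  also have "(\<lambda>m. \<Sum>i\<le>m. (of_real (w i) * cis (real i * t)) * (of_real (Zmn w (m - i) n) * cis (real (m - i) * t)))
      = (\<lambda>m. of_real (Zmn w m (Suc n)) * cis (real m * t))"
  proof
    fix m
    have "(\<Sum>i\<le>m. (of_real (w i) * cis (real i * t)) * (of_real (Zmn w (m - i) n) * cis (real (m - i) * t))) =
        (\<Sum>i\<le>m. of_real (w i * Zmn w (m - i) n) * cis (real m * t))"
    proof (intro sum.cong refl)
      fix i assume "i \<in> {..m}"
      hence "cis (real m * t) = cis (real i * t) * cis (real (m - i) * t)"
        by (simp add: cis_mult of_nat_diff algebra_simps)
      thus "(of_real (w i) * cis (real i * t)) * (of_real (Zmn w (m - i) n) * cis (real (m - i) * t)) =
          of_real (w i * Zmn w (m - i) n) * cis (real m * t)"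
        by simp
    qed
    thus "(\<Sum>i\<le>m. (of_real (w i) * cis (real i * t)) * (of_real (Zmn w (m - i) n) * cis (real (m - i) * t)))
      = of_real (Zmn w m (Suc n)) * cis (real m * t)"
      by (simp add: Zmn_Suc sum_distrib_right)
  qed
  also have "(\<Sum>i. of_real (w i) * cis (real i * t)) * (\<Sum>i. of_real (Zmn w i n) * cis (real i * t)) = chf w t ^ Suc n"
    using sums_unique[OF Suc] by (simp add: chf_def)
  finally show ?case .
qed

lemma has_bochner_integral_cos_Icc_pi:
  fixes k :: int
  shows "has_bochner_integral lborel (\<lambda>t. indicator {0..pi} t *\<^sub>R cos (of_int k * t)) (if k = 0 then pi else 0)"
proof (cases "k = 0")
  case True
  have "has_bochner_integral lborel (indicator {0..pi} :: real \<Rightarrow> real) (measure lborel {0..pi})"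
    by (rule has_bochner_integral_real_indicator) simp_all
  thus ?thesis using True by simp
next
  case False
  have "has_bochner_integral lborel (\<lambda>t. indicator {0..pi} t *\<^sub>R cos (of_int k * t))
      (sin (of_int k * pi) / of_int k - sin (of_int k * 0) / of_int k)"
  proof (rule has_bochner_integral_FTC_Icc)
    show "((\<lambda>t. sin (of_int k * t) / of_int k) has_vector_derivative cos (of_int k * t)) (at t within {0..pi})" for t
      unfolding has_real_derivative_iff_has_vector_derivative [symmetric]
      using False by (auto intro!: derivative_eq_intros)
  qed (auto intro!: continuous_intros)
  thus ?thesis using False by (simp add: sin_int_times_real mult.commute)
qed

text \<open>The weights are real, so the real part of the integrand is a cosine series, even in
  \<open>t\<close>, and half a period suffices. Hence only the behaviour as \<open>t\<close> tends
  to 0 from the right will matter. Sum and integral may be exchanged because the Z(j, n) are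
  summable over \<open>j\<close>.\<close>

lemma Zmn_fourier:
  assumes "\<And>k. w k \<ge> 0" "summable w"
  shows "(\<integral>t. indicator {0..pi} t *\<^sub>R Re (cis (- real m * t) * chf w t ^ n) \<partial>lborel) = pi * Zmn w m n"
proof -
  let ?f = "\<lambda>j t. Zmn w j n * (indicator {0..pi} t *\<^sub>R cos (of_int (int j - int m) * t))"
  have int: "has_bochner_integral lborel (?f j) (Zmn w j n * (if j = m then pi else 0))" for j
    using has_bochner_integral_mult_right[OF has_bochner_integral_cos_Icc_pi[of "int j - int m"], of "Zmn w j n"]
    by (simp split: if_splits)
  have integrable: "integrable lborel (?f j)" for j
    using int by (rule integrable.intros)
  have Z: "summable (\<lambda>j. Zmn w j n)" "\<And>j. Zmn w j n \<ge> 0"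
    using assms by (auto simp: summable_Zmn Zmn_nonneg)
  have bound: "norm (?f j t) \<le> Zmn w j n * indicator {0..pi} t" for j t
    using Z(2)[of j] by (auto simp: indicator_def abs_mult intro: mult_left_le)
  have ind: "integrable lborel (\<lambda>t. Zmn w j n * indicator {0..pi} t)" for j
    by (intro integrable_mult_right) simp
  have "(\<lambda>j. integral\<^sup>L lborel (?f j)) sums (\<integral>t. (\<Sum>j. ?f j t) \<partial>lborel)"
  proof (rule sums_integral)
    show "integrable lborel (?f j)" for j by (rule integrable)
    show "AE t in lborel. summable (\<lambda>j. norm (?f j t))"
    proof (rule AE_I2)
      fix t
      show "summable (\<lambda>j. norm (?f j t))"
        by (rule summable_comparison_test'[where g = "\<lambda>j. Zmn w j n * indicator {0..pi} t" and N = 0])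
           (use bound Z in \<open>auto intro: summable_mult2\<close>)
    qed
    show "summable (\<lambda>j. \<integral>t. norm (?f j t) \<partial>lborel)"
    proof (rule summable_comparison_test'[where g = "\<lambda>j. Zmn w j n * pi" and N = 0])
      show "summable (\<lambda>j. Zmn w j n * pi)" using Z by (auto intro: summable_mult2)
      fix j
      have "(\<integral>t. norm (?f j t) \<partial>lborel) \<le> (\<integral>t. Zmn w j n * indicator {0..pi} t \<partial>lborel)"
        by (rule integral_mono) (use integrable bound ind in \<open>auto simp del: norm_mult norm_scaleR real_norm_def intro: integrable_norm\<close>)
      also have "\<dots> = Zmn w j n * pi" by simp
      finally show "norm (\<integral>t. norm (?f j t) \<partial>lborel) \<le> Zmn w j n * pi"
        by (simp add: integral_nonneg_AE)
    qed
  qed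
  moreover have "(\<Sum>j. ?f j t) = indicator {0..pi} t *\<^sub>R Re (cis (- real m * t) * chf w t ^ n)" for t
  proof -
    have "(\<lambda>j. cis (- real m * t) * (of_real (Zmn w j n) * cis (real j * t))) sums
        (cis (- real m * t) * chf w t ^ n)"
      by (intro sums_mult chf_power_sums assms)
    hence "(\<lambda>j. Re (cis (- real m * t) * (of_real (Zmn w j n) * cis (real j * t)))) sums
        Re (cis (- real m * t) * chf w t ^ n)"
      by (rule sums_Re)
    also have "(\<lambda>j. Re (cis (- real m * t) * (of_real (Zmn w j n) * cis (real j * t)))) =
        (\<lambda>j. Zmn w j n * cos (of_int (int j - int m) * t))"
      by (auto simp: fun_eq_iff algebra_simps cos_diff)
    finally have "(\<lambda>j. indicator {0..pi} t * (Zmn w j n * cos (of_int (int j - int m) * t))) sums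
        (indicator {0..pi} t * Re (cis (- real m * t) * chf w t ^ n))"
      by (rule sums_mult)
    thus ?thesis by (simp add: sums_iff mult_ac)
  qed
  moreover have "(\<lambda>j. integral\<^sup>L lborel (?f j)) sums (\<Sum>j\<in>{m}. Zmn w j n * pi)"
    using sums_finite[of "{m}" "\<lambda>j. integral\<^sup>L lborel (?f j)"]
    by (simp only: has_bochner_integral_integral_eq[OF int]) simp
  ultimately show ?thesis by (simp add: sums_unique2 mult.commute)
qed

section \<open>The integral of a stretched exponential\<close>

text \<open>Substituting y = R s^\<alpha> leads to Euler's integral for Gamma(k + 1/\<alpha>). The
  moments s^(\<alpha> k) are those that arise when a complex exponential is expanded around the real
  one.\<close>

lemma has_bochner_integral_powr_exp_powr:
  fixes \<alpha> R :: real and k :: nat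
  assumes "\<alpha> > 0" "R > 0"
  shows "has_bochner_integral lborel
    (\<lambda>s. indicator {0<..} s *\<^sub>R (s powr (\<alpha> * real k) * exp (- R * s powr \<alpha>)))
    (Gamma (real k + 1/\<alpha>) / \<alpha> * R powr (- real k - 1/\<alpha>))"
proof -
  define x where "x = real k + 1/\<alpha>"
  have x: "x > 0" using assms by (simp add: x_def add_nonneg_pos)
  define g where "g = (\<lambda>s. R * s powr \<alpha>)"
  define h where "h = (\<lambda>s. R * (\<alpha> * s powr (\<alpha> - 1)))"
  define f where "f = (\<lambda>t::real. t powr (x - 1) / exp t)"
  have img: "g ` {0<..} = {0<..}"
  proof (intro equalityI subsetI)
    fix y :: real assume "y \<in> {0<..}"
    moreover from this have "y = g ((y / R) powr (1/\<alpha>))"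
      using assms by (simp add: g_def powr_powr)
    ultimately show "y \<in> g ` {0<..}" using assms by (intro image_eqI[where x = "(y / R) powr (1/\<alpha>)"]) auto
  qed (use assms in \<open>auto simp: g_def\<close>)
  have inj: "inj_on g {0<..}"
  proof (rule inj_onI)
    fix x y :: real assume xy: "x \<in> {0<..}" "y \<in> {0<..}" "g x = g y"
    hence "(x powr \<alpha>) powr (1/\<alpha>) = (y powr \<alpha>) powr (1/\<alpha>)" using assms by (simp add: g_def)
    thus "x = y" using xy assms by (simp add: powr_powr)
  qed
  have der: "(g has_field_derivative h s) (at s within {0<..})" if "s \<in> {0<..}" for s
    unfolding g_def h_def using that assms
    by (auto intro!: derivative_eq_intros DERIV_subset[OF DERIV_cmult[OF DERIV_powr]] simp: powr_diff field_simps)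
  have f_int: "(f has_integral Gamma x) {0<..}"
  proof -
    have "(f has_integral Gamma x) {0..}"
      unfolding f_def by (rule Gamma_integral_real[OF x])
    thus ?thesis
      by (subst (asm) has_integral_spike_set_eq[where T = "{0<..}"]) (auto intro: negligible_subset[of "{0}"])
  qed
  have f_abs: "f absolutely_integrable_on {0<..}"
    by (rule nonnegative_absolutely_integrable_1) (use f_int in \<open>auto simp: f_def has_integral_integrable\<close>)
  have *: "(\<lambda>s. \<bar>h s\<bar> *\<^sub>R f (g s)) absolutely_integrable_on {0<..} \<and>
      integral {0<..} (\<lambda>s. \<bar>h s\<bar> *\<^sub>R f (g s)) = Gamma x"
    by (subst has_absolute_integral_change_of_variables_real[OF _ der inj])
       (use f_int f_abs in \<open>auto simp: img integral_unique\<close>)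
  have eq: "\<bar>h s\<bar> *\<^sub>R f (g s) = (\<alpha> * R powr x) * (s powr (\<alpha> * real k) * exp (- R * s powr \<alpha>))" if "s > 0" for s
  proof -
    have "f (g s) = R powr (x - 1) * s powr (\<alpha> * (x - 1)) * exp (- R * s powr \<alpha>)"
      using that assms by (simp add: f_def g_def powr_mult powr_powr exp_minus field_simps)
    moreover have "s powr (\<alpha> - 1) * s powr (\<alpha> * (x - 1)) = s powr (\<alpha> * real k)"
      using assms that by (simp add: powr_add [symmetric] x_def algebra_simps)
    moreover have "R * R powr (x - 1) = R powr x"
      using assms by (simp add: powr_diff)
    moreover have "\<bar>h s\<bar> = R * \<alpha> * s powr (\<alpha> - 1)"
      using assms by (simp add: h_def)
    ultimately show ?thesis by (simp add: algebra_simps)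
  qed
  let ?u = "\<lambda>s. s powr (\<alpha> * real k) * exp (- R * s powr \<alpha>)"
  have "(\<lambda>s. (\<alpha> * R powr x) * ?u s) absolutely_integrable_on {0<..} \<and>
      integral {0<..} (\<lambda>s. (\<alpha> * R powr x) * ?u s) = Gamma x"
    using * eq set_integrable_cong[of lebesgue lebesgue "{0<..}" "{0<..}" "\<lambda>s. \<bar>h s\<bar> *\<^sub>R f (g s)" "\<lambda>s. (\<alpha> * R powr x) * ?u s"]
     integral_cong[of "{0<..}" "\<lambda>s. \<bar>h s\<bar> *\<^sub>R f (g s)" "\<lambda>s. (\<alpha> * R powr x) * ?u s"] by auto
  hence abs: "(\<lambda>s. (\<alpha> * R powr x) * ?u s) absolutely_integrable_on {0<..}"
    and int: "integral {0<..} (\<lambda>s. (\<alpha> * R powr x) * ?u s) = Gamma x" by auto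
  have pos: "\<alpha> * R powr x > 0" using assms by simp
  have abs': "?u absolutely_integrable_on {0<..}"
  proof -
    have "(\<lambda>s. inverse (\<alpha> * R powr x) * ((\<alpha> * R powr x) * ?u s)) absolutely_integrable_on {0<..}"
      by (intro set_integrable_mult_right abs)
    also have "(\<lambda>s. inverse (\<alpha> * R powr x) * ((\<alpha> * R powr x) * ?u s)) = ?u"
      using assms by (auto simp: fun_eq_iff field_simps)
    finally show ?thesis .
  qed
  \<comment> \<open>The change of variables lives in \<open>lebesgue\<close>; since the integrand is
    Borel, the result passes to \<open>lborel\<close>, where dominated convergence is applied
    later.\<close>
  let ?v = "\<lambda>s. indicator {0<..} s *\<^sub>R ?u s"
  have meas: "?v \<in> borel_measurable lborel" by measurable
  have "integrable lebesgue ?v"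
    using abs' by (simp add: set_integrable_def)
  hence "integrable lborel ?v" using integrable_completion[OF meas] by simp
  moreover have "integral\<^sup>L lborel ?v = Gamma x / (\<alpha> * R powr x)"
  proof -
    have "integral\<^sup>L lborel ?v = integral\<^sup>L lebesgue ?v"
      by (rule integral_completion[OF meas, symmetric])
    also have "\<dots> = integral {0<..} ?u"
      using set_lebesgue_integral_eq_integral(2)[OF abs'] by (simp add: set_lebesgue_integral_def)
    also have "\<dots> = Gamma x / (\<alpha> * R powr x)"
      using int assms by (auto simp: field_simps)
    finally show ?thesis .
  qed
  moreover have "Gamma x / (\<alpha> * R powr x) = Gamma (real k + 1/\<alpha>) / \<alpha> * R powr (- real k - 1/\<alpha>)"
  proof -
    have "R powr (- real k - 1/\<alpha>) = inverse (R powr x)"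
      by (simp add: x_def flip: powr_minus)
    thus ?thesis by (simp add: x_def divide_inverse)
  qed
  ultimately show ?thesis by (simp add: has_bochner_integral_iff)
qed

text \<open>Any \<open>z\<close> in the right half-plane lies in a disc \<open>|R - z| < R\<close>; expand \<open>exp ((R - z) s\<^sup>\<alpha>)\<close>
  and recognise the binomial series of \<open>(1 - (R - z) / R)\<close> to the power \<open>- 1 / \<alpha>\<close>.\<close>
lemma has_bochner_integral_exp_powr:
  fixes \<alpha> :: real and z :: complex
  assumes "\<alpha> > 0" "Re z > 0"
  shows "has_bochner_integral lborel (\<lambda>s. indicator {0<..} s *\<^sub>R exp (- z * of_real (s powr \<alpha>)))
    (of_real (Gamma (1 + 1/\<alpha>)) * z powr (- 1 / of_real \<alpha>))"
proof -
  define \<beta> where "\<beta> = 1/\<alpha>"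
  have \<beta>: "\<beta> > 0" using assms by (simp add: \<beta>_def)
  \<comment> \<open>With this choice |R - z|^2 = R^2 - 2 R Re z + |z|^2 = R^2 - |z|^2, so
    \<open>z\<close> lies strictly inside the disc of radius \<open>R\<close> about
    \<open>R\<close>.\<close>
  define R where "R = (norm z)\<^sup>2 / Re z"
  have R: "R > 0" using assms by (auto simp: R_def intro!: divide_pos_pos)
  define u where "u = of_real R - z"
  have uR: "norm u < R"
  proof -
    have "(norm u)\<^sup>2 = R\<^sup>2 - 2 * R * Re z + (norm z)\<^sup>2"
      unfolding u_def cmod_power2 by (simp add: power2_eq_square algebra_simps)
    also have "\<dots> = R\<^sup>2 - (norm z)\<^sup>2" using assms by (simp add: R_def)
    also have "\<dots> < R\<^sup>2" using assms by auto
    finally show ?thesis using R by (simp add: power2_less_imp_less)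
  qed
  define J where "J = (\<lambda>k::nat. Gamma (real k + \<beta>) / \<alpha> * R powr (- real k - \<beta>))"
  define v where "v = (\<lambda>(k::nat) s. indicator {0<..} s *\<^sub>R (s powr (\<alpha> * real k) * exp (- R * s powr \<alpha>)))"
  have v: "has_bochner_integral lborel (v k) (J k)" for k
    unfolding v_def J_def \<beta>_def by (rule has_bochner_integral_powr_exp_powr) (use assms R in auto)
  define f where "f = (\<lambda>(k::nat) s. (u ^ k / fact k) * of_real (v k s))"
  have f: "has_bochner_integral lborel (f k) (u ^ k / fact k * of_real (J k))" for k
    unfolding f_def by (intro has_bochner_integral_mult_right has_bochner_integral_of_real v)
  have v_nonneg: "v k s \<ge> 0" for k s by (simp add: v_def)
  have norm_f: "has_bochner_integral lborel (\<lambda>s. norm (f k s)) (norm u ^ k / fact k * J k)" for k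
    using has_bochner_integral_mult_right[OF v[of k], of "norm u ^ k / fact k"] v_nonneg
    by (simp add: f_def norm_mult norm_divide norm_power)
  have J: "J k = Gamma \<beta> / \<alpha> * R powr (- \<beta>) * (pochhammer \<beta> k / R ^ k)" for k
  proof -
    have "pochhammer \<beta> k = Gamma (\<beta> + real k) / Gamma \<beta>"
      using \<beta> by (intro pochhammer_Gamma) (auto elim!: nonpos_Ints_cases)
    moreover have "Gamma \<beta> > 0" using \<beta> by (rule Gamma_real_pos)
    moreover have "R powr (- real k - \<beta>) = R powr (- \<beta>) / R ^ k"
      using R by (simp add: powr_diff powr_minus powr_realpow field_simps)
    ultimately show ?thesis by (simp add: J_def field_simps)
  qed
  have gb: "pochhammer \<beta> k / fact k * (x::real) ^ k = ((- \<beta>) gchoose k) * (- x) ^ k" for k x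
    by (simp add: gbinomial_pochhammer power_minus[of x] )
  have sums_f: "(\<lambda>k. u ^ k / fact k * of_real (J k)) sums
      (of_real (Gamma \<beta> / \<alpha> * R powr (- \<beta>)) * (1 - u / of_real R) powr (- of_real \<beta>))"
  proof -
    have "(\<lambda>k. ((- of_real \<beta> :: complex) gchoose k) * (- (u / of_real R)) ^ k) sums
        (1 + (- (u / of_real R))) powr (- of_real \<beta>)"
      by (rule gen_binomial_complex) (use uR R in \<open>simp add: norm_divide\<close>)
    hence "(\<lambda>k. of_real (Gamma \<beta> / \<alpha> * R powr (- \<beta>)) * (((- of_real \<beta> :: complex) gchoose k) * (- (u / of_real R)) ^ k)) sums
        (of_real (Gamma \<beta> / \<alpha> * R powr (- \<beta>)) * (1 - u / of_real R) powr (- of_real \<beta>))"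
      by (subst diff_conv_add_uminus) (rule sums_mult)
    also have "(\<lambda>k. of_real (Gamma \<beta> / \<alpha> * R powr (- \<beta>)) * (((- of_real \<beta> :: complex) gchoose k) * (- (u / of_real R)) ^ k)) =
       (\<lambda>k. u ^ k / fact k * of_real (J k))"
    proof
      fix k :: nat
      have *: "(- 1) ^ k * p * ((- 1) ^ k * q) = p * q" for p q :: complex
        by (cases "even k") auto
      show "of_real (Gamma \<beta> / \<alpha> * R powr (- \<beta>)) * (((- of_real \<beta> :: complex) gchoose k) * (- (u / of_real R)) ^ k) =
          u ^ k / fact k * of_real (J k)"
        by (simp add: J gbinomial_pochhammer power_minus[of "u / _"] power_divide pochhammer_of_real *) (simp add: mult_ac)
    qed
    finally show ?thesis .
  qed
  \<comment> \<open>Up to a constant this is the binomial series of (1 - |u|/R)^(-\<beta>). It makes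
    the integrals of the norms summable and so permits termwise integration.\<close>
  have summable_norm_f: "summable (\<lambda>k. norm u ^ k / fact k * J k)"
  proof -
    have "summable (\<lambda>k. ((- \<beta>) gchoose k) * (- (norm u / R)) ^ k)"
      by (rule sums_summable[OF gen_binomial_real]) (use uR R in simp)
    hence "summable (\<lambda>k. Gamma \<beta> / \<alpha> * R powr (- \<beta>) * (((- \<beta>) gchoose k) * (- (norm u / R)) ^ k))"
      by (rule summable_mult)
    also have "(\<lambda>k. Gamma \<beta> / \<alpha> * R powr (- \<beta>) * (((- \<beta>) gchoose k) * (- (norm u / R)) ^ k)) =
      (\<lambda>k. norm u ^ k / fact k * J k)"
      by (simp only: gb [symmetric] J power_divide) (simp add: mult_ac)
    finally show ?thesis .
  qed
  have suminf_f: "(\<lambda>k. f k s) sums (indicator {0<..} s *\<^sub>R exp (- z * of_real (s powr \<alpha>)))" for s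
  proof (cases "s > 0")
    case True
    have "(\<lambda>k. of_real (exp (- R * s powr \<alpha>)) * ((u * of_real (s powr \<alpha>)) ^ k /\<^sub>R fact k)) sums
        (of_real (exp (- R * s powr \<alpha>)) * exp (u * of_real (s powr \<alpha>)))"
      by (intro sums_mult exp_converges)
    also have "of_real (exp (- R * s powr \<alpha>)) * exp (u * of_real (s powr \<alpha>)) = exp (- z * of_real (s powr \<alpha>))"
      by (simp add: exp_of_real [symmetric] exp_add [symmetric] u_def algebra_simps)
    also have "(\<lambda>k. of_real (exp (- R * s powr \<alpha>)) * ((u * of_real (s powr \<alpha>)) ^ k /\<^sub>R fact k)) = (\<lambda>k. f k s)"
      using True by (auto simp: fun_eq_iff f_def v_def power_mult_distrib scaleR_conv_of_real field_simps
         powr_powr [symmetric] powr_realpow simp flip: of_real_power)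
    finally show ?thesis using True by simp
  next
    case False
    thus ?thesis by (simp add: f_def v_def)
  qed
  have integrable_f: "integrable lborel (f k)" for k using f by (rule integrable.intros)
  have summable_int: "summable (\<lambda>k. \<integral>s. norm (f k s) \<partial>lborel)"
    using summable_norm_f by (simp only: has_bochner_integral_integral_eq[OF norm_f])
  have summable_ptw: "AE s in lborel. summable (\<lambda>k. norm (f k s))"
  proof (rule AE_I2)
    fix s
    have "(\<lambda>k. norm (f k s)) = (\<lambda>k. indicator {0<..} s * exp (- R * s powr \<alpha>) * ((norm u * s powr \<alpha>) ^ k /\<^sub>R fact k))"
      using v_nonneg
      by (auto simp: fun_eq_iff f_def norm_mult norm_divide norm_power v_def power_mult_distrib field_simps
          powr_powr [symmetric] powr_realpow indicator_def)
    thus "summable (\<lambda>k. norm (f k s))"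
      using summable_mult[OF summable_exp_generic[of "norm u * s powr \<alpha>"]] by simp
  qed
  have "(\<lambda>k. integral\<^sup>L lborel (f k)) sums (\<integral>s. (\<Sum>k. f k s) \<partial>lborel)"
    by (rule sums_integral[OF integrable_f summable_ptw summable_int])
  hence "(\<lambda>k. u ^ k / fact k * of_real (J k)) sums
     (\<integral>s. indicator {0<..} s *\<^sub>R exp (- z * of_real (s powr \<alpha>)) \<partial>lborel)"
    by (simp only: has_bochner_integral_integral_eq[OF f] sums_unique[OF suminf_f, symmetric])
  hence "integral\<^sup>L lborel (\<lambda>s. indicator {0<..} s *\<^sub>R exp (- z * of_real (s powr \<alpha>))) =
      of_real (Gamma \<beta> / \<alpha> * R powr (- \<beta>)) * (1 - u / of_real R) powr (- of_real \<beta>)"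
    using sums_f by (rule sums_unique2)
  \<comment> \<open>A positive real factor can be taken out of a principal power, so the auxiliary
    \<open>R\<close> cancels below and only the power of \<open>z\<close> remains.\<close>
  also have "1 - u / of_real R = of_real (1 / R) * z"
    using R by (simp add: u_def field_simps)
  also have "(of_real (1 / R) * z) powr (- of_real \<beta>) =
      of_real ((1 / R) powr (- \<beta>)) * z powr (- of_real \<beta>)"
    using R by (subst powr_times_real_left) (auto simp flip: powr_of_real)
  also have "of_real (Gamma \<beta> / \<alpha> * R powr (- \<beta>)) * (of_real ((1 / R) powr (- \<beta>)) * z powr (- of_real \<beta>)) =
      of_real (Gamma \<beta> / \<alpha> * (R powr (- \<beta>) * (1 / R) powr (- \<beta>))) * z powr (- of_real \<beta>)"
    by simp
  also have "R powr (- \<beta>) * (1 / R) powr (- \<beta>) = 1"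
    using R by (subst powr_mult [symmetric]) auto
  also have "Gamma \<beta> / \<alpha> * 1 = Gamma (1 + \<beta>)"
  proof -
    have "\<beta> \<notin> \<int>\<^sub>\<le>\<^sub>0" using \<beta> by (auto elim!: nonpos_Ints_cases)
    thus ?thesis using Gamma_plus1[of \<beta>] by (simp add: \<beta>_def add.commute)
  qed
  finally show ?thesis
    using integrable_suminf[OF integrable_f summable_ptw summable_int]
    by (simp add: \<beta>_def has_bochner_integral_iff sums_unique[OF suminf_f, symmetric])
qed

section \<open>A local limit theorem\<close>

text \<open>With u_n = x_n / n one has Ln(1 + u_n) - u_n = O(|u_n|^2), and n |u_n|^2 = |x_n| |u_n|
  tends to 0. For small u_n the base is nonzero, so the power equals exp(n Ln(1 + u_n)).\<close>

lemma tendsto_one_plus_power: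
  fixes x :: "nat \<Rightarrow> complex"
  assumes "x \<longlonglongrightarrow> a"
  shows "(\<lambda>n. (1 + x n / of_nat n) ^ n) \<longlonglongrightarrow> exp a"
proof -
  define u where "u = (\<lambda>n. x n / of_nat n)"
  have u0: "u \<longlonglongrightarrow> 0"
    unfolding u_def using tendsto_mult[OF assms lim_inverse_n[where 'a = complex]]
    by (simp add: divide_inverse)
  have small: "eventually (\<lambda>n. norm (u n) < 1/2) sequentially"
    using order_tendstoD(2)[OF tendsto_norm_zero[OF u0], of "1/2"] by simp
  have "(\<lambda>n. of_nat n * (Ln (1 + u n) - u n)) \<longlonglongrightarrow> 0"
  proof (rule Lim_null_comparison)
    show "eventually (\<lambda>n. norm (of_nat n * (Ln (1 + u n) - u n)) \<le> 2 * (norm (x n) * norm (u n))) sequentially"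
      using small eventually_gt_at_top[of 0]
    proof eventually_elim
      case (elim n)
      have "norm (Ln (1 + u n) - u n) \<le> (norm (u n))\<^sup>2 / (1 - norm (u n))"
        using elim by (intro Ln_approx_linear) auto
      also have "\<dots> \<le> (norm (u n))\<^sup>2 / (1/2)"
        using elim by (intro divide_left_mono) auto
      finally have "real n * norm (Ln (1 + u n) - u n) \<le> real n * (2 * (norm (u n))\<^sup>2)"
        by (intro mult_left_mono) auto
      also have "\<dots> = 2 * (norm (x n) * norm (u n))"
        using elim by (simp add: u_def norm_divide power2_eq_square)
      finally show ?case by (simp add: norm_mult)
    qed
    show "(\<lambda>n. 2 * (norm (x n) * norm (u n))) \<longlonglongrightarrow> 0"
      by (rule tendsto_eq_intros tendsto_norm assms u0 refl)+ simp
  qed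
  from tendsto_add[OF this assms]
  have "(\<lambda>n. exp (of_nat n * (Ln (1 + u n) - u n) + x n)) \<longlonglongrightarrow> exp a"
    by (intro tendsto_exp) simp
  moreover have "eventually (\<lambda>n. exp (of_nat n * (Ln (1 + u n) - u n) + x n) = (1 + x n / of_nat n) ^ n) sequentially"
    using small eventually_gt_at_top[of 0]
  proof eventually_elim
    case (elim n)
    have "1 + u n \<noteq> 0"
    proof
      assume "1 + u n = 0"
      hence "u n = - 1" by (simp add: add_eq_0_iff)
      thus False using elim by simp
    qed
    moreover have "of_nat n * (Ln (1 + u n) - u n) + x n = of_nat n * Ln (1 + u n)"
      using elim by (simp add: u_def field_simps)
    ultimately show ?case by (simp add: exp_of_nat_mult u_def)
  qed
  ultimately show ?thesis by (rule Lim_transform_eventually)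
qed

lemma continuous_on_chf:
  assumes "\<And>k. p k \<ge> 0" "summable p"
  shows "continuous_on A (chf p)"
proof -
  have "uniform_limit UNIV (\<lambda>n t. \<Sum>k<n. of_real (p k) * cis (real k * t))
      (\<lambda>t. \<Sum>k. of_real (p k) * cis (real k * t)) sequentially"
    by (rule Weierstrass_m_test[where M = p]) (use assms in \<open>auto simp: norm_mult\<close>)
  hence "continuous_on UNIV (\<lambda>t. \<Sum>k. of_real (p k) * cis (real k * t))"
    by (rule uniform_limit_theorem[rotated]) (auto intro!: always_eventually continuous_intros)
  thus ?thesis by (auto simp: chf_def[abs_def] intro: continuous_on_subset)
qed

lemma norm_chf_le:
  assumes "\<And>k. p k \<ge> 0" "p sums s"
  shows "norm (chf p t) \<le> s"
  by (rule norm_sums_le[OF chf_sums assms(2)]) (use assms in \<open>auto simp: norm_mult sums_iff\<close>)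

text \<open>The terms with indices \<open>K\<close> and \<open>K + 1\<close> differ in phase by
  \<open>t\<close>, which lies in (0, pi], so the triangle inequality is strict on this pair; the
  other terms are bounded by their absolute values.\<close>

lemma norm_chf_less:
  assumes p: "\<And>k. p k \<ge> 0" "p sums s" and K: "p K > 0" "p (Suc K) > 0" and t: "0 < t" "t \<le> pi"
  shows "norm (chf p t) < s"
proof -
  let ?A = "{K, Suc K}"
  let ?e = "\<lambda>k. of_real (p k) * cis (real k * t)"
  have "(\<lambda>k. ?e k - (if k \<in> ?A then ?e k else 0)) sums (chf p t - (\<Sum>k\<in>?A. ?e k))"
    by (intro sums_diff chf_sums sums_If_finite_set) (use p in \<open>auto simp: sums_iff\<close>)
  moreover have "(\<lambda>k. p k - (if k \<in> ?A then p k else 0)) sums (s - (\<Sum>k\<in>?A. p k))"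
    by (intro sums_diff sums_If_finite_set p) auto
  ultimately have "norm (chf p t - (\<Sum>k\<in>?A. ?e k)) \<le> s - (\<Sum>k\<in>?A. p k)"
    by (rule norm_sums_le) (use p in \<open>auto simp: norm_mult\<close>)
  hence "norm (chf p t) \<le> norm (\<Sum>k\<in>?A. ?e k) + (s - p K - p (Suc K))"
    using norm_triangle_ineq2[of "chf p t" "\<Sum>k\<in>?A. ?e k"] by simp
  moreover have "norm (\<Sum>k\<in>?A. ?e k) < p K + p (Suc K)"
  proof -
    have "(\<Sum>k\<in>?A. ?e k) = cis (real K * t) * (of_real (p K) + of_real (p (Suc K)) * cis t)"
      by (simp add: algebra_simps cis_mult)
    hence eq: "norm (\<Sum>k\<in>?A. ?e k) = norm (of_real (p K) + of_real (p (Suc K)) * cis t)"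
      by (simp add: norm_mult)
    have "(norm (of_real (p K) + of_real (p (Suc K)) * cis t))\<^sup>2 =
        (p K)\<^sup>2 + (p (Suc K))\<^sup>2 * ((cos t)\<^sup>2 + (sin t)\<^sup>2) + 2 * (p K * p (Suc K)) * cos t"
      unfolding cmod_power2 by (simp add: power2_eq_square algebra_simps del: sin_cos_squared_add sin_cos_squared_add2 sin_cos_squared_add3)
    also have "\<dots> = (p K)\<^sup>2 + (p (Suc K))\<^sup>2 + 2 * (p K * p (Suc K)) * cos t" by simp
    also have "\<dots> < (p K)\<^sup>2 + (p (Suc K))\<^sup>2 + 2 * (p K * p (Suc K)) * 1"
      using K t cos_monotone_0_pi[of 0 t] by (intro add_strict_left_mono mult_strict_left_mono) auto
    also have "\<dots> = (p K + p (Suc K))\<^sup>2" by (simp add: power2_eq_square algebra_simps)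
    finally show ?thesis unfolding eq by (rule power2_less_imp_less) (use K in simp)
  qed
  ultimately show ?thesis by simp
qed

lemma norm_chf_bound_away_from_0:
  assumes p: "\<And>k. p k \<ge> 0" "p sums 1" and K: "p K > 0" "p (Suc K) > 0" and "0 < \<delta>"
  obtains q where "0 < q" "q < 1" "\<And>t. \<delta> \<le> t \<Longrightarrow> t \<le> pi \<Longrightarrow> norm (chf p t) \<le> q"
proof (cases "\<delta> \<le> pi")
  case True
  have "continuous_on {\<delta>..pi} (\<lambda>t. norm (chf p t))"
    by (intro continuous_on_norm continuous_on_chf) (use p in \<open>auto simp: sums_iff\<close>)
  then obtain t0 where t0: "t0 \<in> {\<delta>..pi}" "\<And>t. t \<in> {\<delta>..pi} \<Longrightarrow> norm (chf p t) \<le> norm (chf p t0)"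
    using continuous_attains_sup[of "{\<delta>..pi}" "\<lambda>t. norm (chf p t)"] True by auto
  have "norm (chf p t0) < 1"
    using t0 assms by (intro norm_chf_less[where K = K]) auto
  \<comment> \<open>The maximum with 1/2 keeps \<open>q\<close> positive, since \<open>ln q\<close>
    is used later.\<close>
  thus ?thesis using t0 by (intro that[of "max (1/2) (norm (chf p t0))"]) (auto simp: le_max_iff_disj)
next
  case False
  thus ?thesis by (intro that[of "1/2"]) auto
qed

text \<open>Writing \<psi> = 1 + L r gives |\<psi>|^2 = 1 + L (2 Re r + L |r|^2). The bracket tends
  to -2 Re \<zeta>, so it is eventually below -Re \<zeta>; then 1 + y \<le> e^y and a square root
  give the exponent Re \<zeta> / 2.\<close>

lemma norm_bound_near_0:
  fixes \<psi> :: "real \<Rightarrow> complex" and L :: "real \<Rightarrow> real"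
  assumes lim: "((\<lambda>t. (\<psi> t - 1) / of_real (L t)) \<longlongrightarrow> - \<zeta>) (at_right 0)"
    and L: "(L \<longlongrightarrow> 0) (at_right 0)" "eventually (\<lambda>t. L t > 0) (at_right 0)" and \<zeta>: "Re \<zeta> > 0"
  shows "eventually (\<lambda>t. norm (\<psi> t) \<le> exp (- (Re \<zeta> / 2) * L t)) (at_right 0)"
proof -
  define r where "r = (\<lambda>t. (\<psi> t - 1) / of_real (L t))"
  have r: "(r \<longlongrightarrow> - \<zeta>) (at_right 0)" using lim by (simp add: r_def)
  have "((\<lambda>t. 2 * Re (r t) + L t * (norm (r t))\<^sup>2) \<longlongrightarrow> 2 * Re (- \<zeta>) + 0 * (norm (- \<zeta>))\<^sup>2) (at_right 0)"
    by (intro tendsto_intros r L)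
  hence "eventually (\<lambda>t. 2 * Re (r t) + L t * (norm (r t))\<^sup>2 < - Re \<zeta>) (at_right 0)"
    by (rule order_tendstoD) (use \<zeta> in simp)
  with L(2) show ?thesis
  proof eventually_elim
    case (elim t)
    have "\<psi> t = 1 + of_real (L t) * r t" using elim by (simp add: r_def)
    hence "(norm (\<psi> t))\<^sup>2 = 1 + L t * (2 * Re (r t) + L t * (norm (r t))\<^sup>2)"
      unfolding cmod_power2 by (simp add: power2_eq_square algebra_simps)
    also have "\<dots> \<le> 1 + L t * (- Re \<zeta>)"
      using elim by (intro add_left_mono mult_left_mono) auto
    also have "\<dots> \<le> exp (L t * (- Re \<zeta>))" by (rule exp_ge_add_one_self)
    also have "\<dots> = (exp (- (Re \<zeta> / 2) * L t))\<^sup>2"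
      by (simp add: exp_double [symmetric] mult_ac)
    finally show ?case by (rule power2_le_imp_le) simp
  qed
qed

text \<open>Here \<open>L\<close> is the order of the centred characteristic function minus 1 at the
  origin, and \<open>b n\<close> is the scale at which \<open>n * L (s / b n)\<close> has the limit
  \<kappa> s^\<alpha>. Keeping \<open>L\<close> abstract covers both t^\<alpha> and t^2 (-ln t). The
  lower bound s / 2 for \<open>n * L (s / b n)\<close> supplies an integrable majorant near the
  origin, and \<open>b n \<le> n\<close> lets the geometric decay take over on the rest of the
  half-period. The limit is the integral of exp(-\<zeta> \<kappa> s^\<alpha>) over the half-line,
  divided by pi.\<close>

theorem local_limit:
  fixes p b :: "nat \<Rightarrow> real" and L :: "real \<Rightarrow> real" and m :: "nat \<Rightarrow> nat"
  assumes p: "\<And>k. p k \<ge> 0" "p sums 1" and K: "p K > 0" "p (Suc K) > 0"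
    and lim: "((\<lambda>t. (cis (- \<mu> * t) * chf p t - 1) / of_real (L t)) \<longlongrightarrow> - \<zeta>) (at_right 0)"
    and L: "(L \<longlongrightarrow> 0) (at_right 0)" "eventually (\<lambda>t. L t > 0) (at_right 0)"
    and pos: "Re \<zeta> > 0" "\<kappa> > 0" "\<alpha> > 0"
    and b: "filterlim b at_top sequentially" "eventually (\<lambda>n. b n \<le> real n) sequentially"
    and scale: "\<And>s. s > 0 \<Longrightarrow> (\<lambda>n. real n * L (s / b n)) \<longlonglongrightarrow> \<kappa> * s powr \<alpha>"
    and \<delta>\<^sub>0: "\<delta>\<^sub>0 > 0"
    and dom: "eventually (\<lambda>n. \<forall>s. 1 \<le> s \<and> s \<le> \<delta>\<^sub>0 * b n \<longrightarrow> s / 2 \<le> real n * L (s / b n)) sequentially"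
    and m: "(\<lambda>n. (real (m n) - \<mu> * real n) / b n) \<longlonglongrightarrow> 0"
  shows "(\<lambda>n. b n * Zmn p (m n) n) \<longlonglongrightarrow>
    Re (of_real (Gamma (1 + 1/\<alpha>)) * (\<zeta> * of_real \<kappa>) powr (- 1 / of_real \<alpha>)) / pi"
proof -
  have summ: "summable p" using p by (simp add: sums_iff)
  define \<psi> where "\<psi> = (\<lambda>t. cis (- \<mu> * t) * chf p t)"
  have norm_\<psi>: "norm (\<psi> t) = norm (chf p t)" for t by (simp add: \<psi>_def norm_mult)
  define a\<^sub>1 where "a\<^sub>1 = Re \<zeta> / 2"
  have a1: "a\<^sub>1 > 0" using pos by (simp add: a\<^sub>1_def)
  have "eventually (\<lambda>t. norm (\<psi> t) \<le> exp (- a\<^sub>1 * L t)) (at_right 0)"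
    unfolding a\<^sub>1_def \<psi>_def by (rule norm_bound_near_0[OF lim L pos(1)])
  then obtain \<delta>\<^sub>1 where \<delta>1: "\<delta>\<^sub>1 > 0" "\<And>t. 0 < t \<Longrightarrow> t < \<delta>\<^sub>1 \<Longrightarrow> norm (\<psi> t) \<le> exp (- a\<^sub>1 * L t)"
    by (auto simp: eventually_at_right_field)
  define \<delta> where "\<delta> = min \<delta>\<^sub>0 (\<delta>\<^sub>1 / 2)"
  have \<delta>: "\<delta> > 0" "\<delta> \<le> \<delta>\<^sub>0" "\<delta> < \<delta>\<^sub>1" using \<delta>\<^sub>0 \<delta>1(1) by (auto simp: \<delta>_def)
  obtain q where q: "0 < q" "q < 1" "\<And>t. \<delta> \<le> t \<Longrightarrow> t \<le> pi \<Longrightarrow> norm (chf p t) \<le> q"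
    using norm_chf_bound_away_from_0[OF p K \<delta>(1)] by blast
  \<comment> \<open>One rate for two ranges: near the origin exp(-a\<cdot>s) must majorise exp(-(Re
    \<zeta> / 2) (s / 2)), and farther out it must majorise q^n for all s up to pi n.\<close>
  define a where "a = min (a\<^sub>1 / 2) (- ln q / pi)"
  have "- ln q / pi > 0" using q by (intro divide_pos_pos) auto
  hence a: "a > 0" "a \<le> a\<^sub>1 / 2" "a \<le> - ln q / pi"
    using a1 unfolding a_def by linarith+
  have a_pi: "a * pi \<le> - ln q" using mult_right_mono[OF a(3), of pi] by simp
  define G where "G = (\<lambda>n s. indicator {0..pi} (s / b n) *\<^sub>R
     Re (cis (- real (m n) * (s / b n)) * chf p (s / b n) ^ n))"
  define g where "g = (\<lambda>s. indicator {0<..} s *\<^sub>R exp (- (\<zeta> * of_real \<kappa>) * of_real (s powr \<alpha>)))"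
  \<comment> \<open>The factor e^a makes the majorant at least 1 for s < 1, where only |chf| \<le> 1
    is used.\<close>
  define W where "W = (\<lambda>s. indicator {0<..} s * exp (a * (1 - s)))"
  have g: "has_bochner_integral lborel g
      (of_real (Gamma (1 + 1/\<alpha>)) * (\<zeta> * of_real \<kappa>) powr (- 1 / of_real \<alpha>))"
    unfolding g_def by (rule has_bochner_integral_exp_powr) (use pos in auto)
  have W: "integrable lborel W"
  proof -
    have "integrable lborel (\<lambda>s. exp a * (indicator {0<..} s *\<^sub>R (s powr (1 * real 0) * exp (- a * s powr 1))))"
      using has_bochner_integral_powr_exp_powr[of 1 a 0] a
      by (intro integrable_mult_right) (rule integrable.intros, auto)
    also have "(\<lambda>s. exp a * (indicator {0<..} s *\<^sub>R (s powr (1 * real 0) * exp (- a * s powr 1)))) = W"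
      by (auto simp: W_def fun_eq_iff indicator_def exp_add [symmetric] algebra_simps)
    finally show ?thesis .
  qed
  have b_pos: "eventually (\<lambda>n. b n > 0) sequentially"
    using b(1) by (simp add: filterlim_at_top_dense)
  have [measurable]: "chf p \<in> borel_measurable borel"
    by (rule borel_measurable_continuous_onI) (rule continuous_on_chf[OF p(1) summ])
  have [measurable]: "cis \<in> borel_measurable borel"
    by (intro borel_measurable_continuous_onI continuous_intros)
  have Gm: "G n \<in> borel_measurable lborel" for n
    unfolding G_def by measurable
  have rescaled: "eventually (\<lambda>n. integral\<^sup>L lborel (G n) = pi * (b n * Zmn p (m n) n)) sequentially"
    using b_pos
  proof eventually_elim
    case (elim n)
    have "pi * Zmn p (m n) n =
      (\<integral>t. indicator {0..pi} t *\<^sub>R Re (cis (- real (m n) * t) * chf p t ^ n) \<partial>lborel)"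
      by (rule Zmn_fourier[OF p(1) summ, symmetric])
    also have "\<dots> = \<bar>1 / b n\<bar> *\<^sub>R integral\<^sup>L lborel (G n)"
      using elim by (subst lborel_integral_real_affine[where c = "1 / b n" and t = 0]) (auto simp: G_def)
    finally show ?case using elim by (simp add: field_simps)
  qed
  have conv: "(\<lambda>n. G n s) \<longlonglongrightarrow> Re (g s)" if "s \<noteq> 0" for s
  proof (cases "s > 0")
    case False
    have "eventually (\<lambda>n. G n s = 0) sequentially"
      using b_pos
    proof eventually_elim
      case (elim n)
      thus ?case using False that by (auto simp: G_def indicator_def zero_le_divide_iff)
    qed
    thus ?thesis using False by (auto simp: g_def tendsto_eventually)
  next
    case s: True
    have sb: "filterlim (\<lambda>n. s / b n) (at_right 0) sequentially"
      unfolding filterlim_at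
      using b_pos s by (auto intro!: real_tendsto_divide_at_top[OF tendsto_const b(1)] elim!: eventually_mono)
    have sbpi: "eventually (\<lambda>n. s / b n \<le> pi) sequentially"
    proof -
      have "eventually (\<lambda>n. b n \<ge> s / pi) sequentially"
        using b(1) by (simp add: filterlim_at_top)
      with b_pos show ?thesis by eventually_elim (simp add: field_simps)
    qed
    have Lpos: "eventually (\<lambda>n. L (s / b n) > 0) sequentially"
      by (rule eventually_compose_filterlim[OF L(2) sb])
    have lim_s: "(\<lambda>n. (\<psi> (s / b n) - 1) / of_real (L (s / b n))) \<longlonglongrightarrow> - \<zeta>"
      unfolding \<psi>_def by (rule filterlim_compose[OF lim sb])
    have "(\<lambda>n. of_real (real n * L (s / b n)) * ((\<psi> (s / b n) - 1) / of_real (L (s / b n)))) \<longlonglongrightarrow>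
        of_real (\<kappa> * s powr \<alpha>) * (- \<zeta>)"
      by (rule tendsto_mult[OF tendsto_of_real[OF scale[OF s]] lim_s])
    moreover have "eventually (\<lambda>n. of_real (real n * L (s / b n)) * ((\<psi> (s / b n) - 1) / of_real (L (s / b n))) =
        of_nat n * (\<psi> (s / b n) - 1)) sequentially"
      using Lpos by eventually_elim simp
    ultimately have "(\<lambda>n. of_nat n * (\<psi> (s / b n) - 1)) \<longlonglongrightarrow> of_real (\<kappa> * s powr \<alpha>) * (- \<zeta>)"
      by (rule Lim_transform_eventually)
    hence "(\<lambda>n. (1 + of_nat n * (\<psi> (s / b n) - 1) / of_nat n) ^ n) \<longlonglongrightarrow> exp (of_real (\<kappa> * s powr \<alpha>) * (- \<zeta>))"
      by (rule tendsto_one_plus_power)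
    \<comment> \<open>The deviation of \<open>m n\<close> from the mean is o(\<open>b n\<close>), so
      its phase disappears in the limit.\<close>
    moreover have "(\<lambda>n. cis (- ((real (m n) - \<mu> * real n) / b n * s))) \<longlonglongrightarrow> cis (- (0 * s))"
      by (intro tendsto_cis tendsto_intros m)
    ultimately have "(\<lambda>n. Re (cis (- ((real (m n) - \<mu> * real n) / b n * s)) *
        (1 + of_nat n * (\<psi> (s / b n) - 1) / of_nat n) ^ n)) \<longlonglongrightarrow>
        Re (cis (- (0 * s)) * exp (of_real (\<kappa> * s powr \<alpha>) * (- \<zeta>)))"
      by (intro tendsto_Re tendsto_mult)
    also have "Re (cis (- (0 * s)) * exp (of_real (\<kappa> * s powr \<alpha>) * (- \<zeta>))) = Re (g s)"
      using s by (simp add: g_def mult_ac)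
    finally have "(\<lambda>n. Re (cis (- ((real (m n) - \<mu> * real n) / b n * s)) *
        (1 + of_nat n * (\<psi> (s / b n) - 1) / of_nat n) ^ n)) \<longlonglongrightarrow> Re (g s)" .
    moreover have "eventually (\<lambda>n. Re (cis (- ((real (m n) - \<mu> * real n) / b n * s)) *
        (1 + of_nat n * (\<psi> (s / b n) - 1) / of_nat n) ^ n) = G n s) sequentially"
      using b_pos sbpi eventually_gt_at_top[of 0]
    proof eventually_elim
      case (elim n)
      \<comment> \<open>The centring removed from \<open>m n\<close> reappears as the
        \<open>n\<close>-th power of the factor in \<psi>, so the total phase is exactly that of the
        Fourier integrand.\<close>
      have "cis (- ((real (m n) - \<mu> * real n) / b n * s)) * \<psi> (s / b n) ^ n =
          cis (- ((real (m n) - \<mu> * real n) / b n * s) + real n * (- \<mu> * (s / b n))) * chf p (s / b n) ^ n"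
        by (simp only: \<psi>_def power_mult_distrib Complex.DeMoivre cis_mult [symmetric] mult.assoc)
      also have "- ((real (m n) - \<mu> * real n) / b n * s) + real n * (- \<mu> * (s / b n)) = - real (m n) * (s / b n)"
        by (simp add: diff_divide_distrib algebra_simps)
      finally have "cis (- ((real (m n) - \<mu> * real n) / b n * s)) * \<psi> (s / b n) ^ n =
          cis (- real (m n) * (s / b n)) * chf p (s / b n) ^ n" .
      thus ?case using elim s by (simp add: G_def)
    qed
    ultimately show ?thesis by (rule Lim_transform_eventually)
  qed
  have bound: "eventually (\<lambda>n. \<forall>s. s \<noteq> 0 \<longrightarrow> norm (G n s) \<le> W s) sequentially"
    using b_pos b(2) dom
  proof (eventually_elim, safe)
    fix n and s :: real
    assume n: "b n > 0" "b n \<le> real n" "s \<noteq> 0"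
      and dom: "\<forall>s. 1 \<le> s \<and> s \<le> \<delta>\<^sub>0 * b n \<longrightarrow> s / 2 \<le> real n * L (s / b n)"
    show "norm (G n s) \<le> W s"
    proof (cases "0 < s \<and> s / b n \<le> pi")
      case False
      hence "G n s = 0" using n by (auto simp: G_def indicator_def zero_le_divide_iff)
      thus ?thesis by (simp add: W_def)
    next
      case True
      hence s: "0 < s" "s / b n \<le> pi" by auto
      have "norm (G n s) \<le> norm (Re (cis (- real (m n) * (s / b n)) * chf p (s / b n) ^ n))"
        by (simp add: G_def indicator_def)
      also have "\<dots> \<le> norm (cis (- real (m n) * (s / b n)) * chf p (s / b n) ^ n)"
        unfolding real_norm_def by (rule abs_Re_le_cmod)
      also have "\<dots> = norm (chf p (s / b n)) ^ n"
        by (simp add: norm_mult norm_power)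
      also have "\<dots> \<le> exp (a * (1 - s))"
      proof -
        \<comment> \<open>The bounds are |chf| \<le> 1 for small s, the expansion at the origin up
          to t = \<delta>, and the uniform bound q on the rest of the half-period.\<close>
        consider "s < 1" | "s \<ge> 1" "s \<le> \<delta> * b n" | "s > \<delta> * b n" by linarith
        thus ?thesis
        proof cases
          case 1
          have "norm (chf p (s / b n)) ^ n \<le> 1"
            by (intro power_le_one norm_chf_le p) auto
          also have "\<dots> \<le> exp (a * (1 - s))" using 1 a by simp
          finally show ?thesis .
        next
          case 2
          have "s / b n \<le> \<delta>" using 2 n by (simp add: field_simps)
          hence "norm (chf p (s / b n)) \<le> exp (- a\<^sub>1 * L (s / b n))"
            using \<delta>1(2)[of "s / b n"] \<delta> s n by (simp add: norm_\<psi>)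
          hence "norm (chf p (s / b n)) ^ n \<le> exp (- a\<^sub>1 * L (s / b n)) ^ n"
            by (rule power_mono) simp
          also have "\<dots> = exp (- a\<^sub>1 * (real n * L (s / b n)))"
            by (simp add: exp_of_nat_mult [symmetric] mult_ac)
          also have "\<dots> \<le> exp (a * (1 - s))"
          proof -
            have "\<delta> * b n \<le> \<delta>\<^sub>0 * b n" using \<delta> n by (intro mult_right_mono) auto
            hence "s / 2 \<le> real n * L (s / b n)" using dom 2 by force
            hence "a\<^sub>1 * (s / 2) \<le> a\<^sub>1 * (real n * L (s / b n))" using a1 by (intro mult_left_mono) simp_all
            moreover have "a * s \<le> a\<^sub>1 / 2 * s" using a(2) s(1) by (intro mult_right_mono) simp_all
            ultimately have "- a\<^sub>1 * (real n * L (s / b n)) \<le> a - a * s" using a(1) by simp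
            thus ?thesis by (simp add: right_diff_distrib)
          qed
          finally show ?thesis .
        next
          case 3
          have "norm (chf p (s / b n)) ^ n \<le> q ^ n"
            using 3 n s by (intro power_mono q) (auto simp: field_simps)
          also have "\<dots> = exp (real n * ln q)" using q by (simp add: exp_of_nat_mult)
          also have "\<dots> \<le> exp (a * (1 - s))"
          proof -
            have "s \<le> pi * real n"
            proof -
              have "s = (s / b n) * b n" using n(1) by simp
              also have "\<dots> \<le> pi * real n" using s(2) n by (intro mult_mono) simp_all
              finally show ?thesis .
            qed
            hence "a * s \<le> a * (pi * real n)" using a(1) by (intro mult_left_mono) simp_all
            moreover have "(a * pi) * real n \<le> (- ln q) * real n"
              by (rule mult_right_mono[OF a_pi]) simp
            moreover have "real n * ln q = - ((- ln q) * real n)" "a * (pi * real n) = (a * pi) * real n"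
              by simp_all
            ultimately have "real n * ln q \<le> a - a * s" using a(1) by linarith
            thus ?thesis by (simp add: right_diff_distrib)
          qed
          finally show ?thesis .
        qed
      qed
      finally show ?thesis using s by (simp add: W_def)
    qed
  qed
  then obtain N where N: "\<And>n s. n \<ge> N \<Longrightarrow> s \<noteq> 0 \<Longrightarrow> norm (G n s) \<le> W s"
    by (auto simp: eventually_sequentially)
  have "(\<lambda>n. integral\<^sup>L lborel (G (n + N))) \<longlonglongrightarrow> integral\<^sup>L lborel (\<lambda>s. Re (g s))"
  proof (rule integral_dominated_convergence[where w = W])
    show "(\<lambda>s. Re (g s)) \<in> borel_measurable lborel"
      using borel_measurable_integrable[OF integrable.intros[OF g]] by measurable
    show "AE s in lborel. (\<lambda>n. G (n + N) s) \<longlonglongrightarrow> Re (g s)"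
      using AE_lborel_singleton[of 0] by eventually_elim (intro LIMSEQ_ignore_initial_segment conv)
    show "AE s in lborel. norm (G (n + N) s) \<le> W s" for n
      using AE_lborel_singleton[of 0] by eventually_elim (intro N, auto)
  qed (use Gm W in auto)
  hence "(\<lambda>n. integral\<^sup>L lborel (G n)) \<longlonglongrightarrow> integral\<^sup>L lborel (\<lambda>s. Re (g s))"
    by (rule LIMSEQ_offset)
  also have "integral\<^sup>L lborel (\<lambda>s. Re (g s)) =
      Re (of_real (Gamma (1 + 1/\<alpha>)) * (\<zeta> * of_real \<kappa>) powr (- 1 / of_real \<alpha>))"
    using has_bochner_integral_Re[OF g] by (rule has_bochner_integral_integral_eq)
  finally have "(\<lambda>n. pi * (b n * Zmn p (m n) n)) \<longlonglongrightarrow>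
      Re (of_real (Gamma (1 + 1/\<alpha>)) * (\<zeta> * of_real \<kappa>) powr (- 1 / of_real \<alpha>))"
    using rescaled by (rule Lim_transform_eventually)
  from tendsto_divide[OF this tendsto_const[of pi]] show ?thesis by simp
qed

section \<open>Comparison with an explicit power series\<close>

lemma x_minus_sin_le:
  fixes x :: real
  assumes "x \<ge> 0"
  shows "0 \<le> x - sin x" "x - sin x \<le> x\<^sup>2 / 2"
proof -
  show "0 \<le> x - sin x" using sin_x_le_x[OF assms] by simp
  have "0\<^sup>2 / 2 - (0 - sin 0) \<le> x\<^sup>2 / 2 - (x - sin x)"
  proof (rule DERIV_nonneg_imp_nondecreasing[OF assms])
    fix y :: real assume y: "0 \<le> y" "y \<le> x"
    have "((\<lambda>x. x\<^sup>2 / 2 - (x - sin x)) has_real_derivative (y - (1 - cos y))) (at y)"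
      by (auto intro!: derivative_eq_intros)
    moreover have "1 - cos y \<le> y"
    proof -
      have "0 - 0 + cos 0 \<le> y - 0 + cos y"
      proof (rule DERIV_nonneg_imp_nondecreasing[OF y(1)])
        fix z :: real
        have "((\<lambda>x. x - 0 + cos x) has_real_derivative (1 - sin z)) (at z)"
          by (auto intro!: derivative_eq_intros)
        thus "\<exists>D. ((\<lambda>x. x - 0 + cos x) has_real_derivative D) (at z) \<and> 0 \<le> D" by (intro exI conjI) auto
      qed
      thus ?thesis by simp
    qed
    ultimately show "\<exists>D. ((\<lambda>x. x\<^sup>2 / 2 - (x - sin x)) has_real_derivative D) (at y) \<and> 0 \<le> D"
      by (intro exI conjI) auto
  qed
  thus "x - sin x \<le> x\<^sup>2 / 2" by simp
qed

lemma norm_cis_taylor_le: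
  assumes "x \<ge> 0"
  shows "norm (cis x - 1 - \<i> * of_real x) \<le> x\<^sup>2"
proof -
  have "1 - cos x \<le> x\<^sup>2 / 2"
  proof -
    have "1 - cos x = 2 * (sin (x / 2))\<^sup>2" using cos_double_sin[of "x / 2"] by simp
    also have "(sin (x / 2))\<^sup>2 \<le> (x / 2)\<^sup>2"
      using abs_sin_x_le_abs_x abs_le_square_iff by blast
    finally show ?thesis by (simp add: power2_eq_square)
  qed
  moreover have "norm (cis x - 1 - \<i> * of_real x) \<le> \<bar>cos x - 1\<bar> + \<bar>sin x - x\<bar>"
    using cmod_le[of "cis x - 1 - \<i> * of_real x"] by simp
  ultimately show ?thesis using x_minus_sin_le[OF assms] cos_le_one[of x] by linarith
qed

text \<open>Both come from e^(-y) \<le> 1 / (1 + y), the first by comparing derivatives. The lower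
  bound x^2 / (2 (1 + x)) has the correct order both at 0 and at infinity.\<close>

lemma exp_taylor_bounds:
  fixes x :: real
  assumes "x \<ge> 0"
  shows "x\<^sup>2 / (2 * (1 + x)) \<le> exp (- x) - 1 + x" "exp (- x) - 1 + x \<le> x\<^sup>2"
proof -
  have e: "exp (- y) \<le> 1 / (1 + y)" if "y \<ge> 0" for y :: real
    using exp_ge_add_one_self[of y] that by (simp add: exp_minus divide_simps)
  have "exp (- 0) - 1 + 0 - 0\<^sup>2 / (2 * (1 + 0)) \<le> exp (- x) - 1 + x - x\<^sup>2 / (2 * (1 + x))"
  proof (rule DERIV_nonneg_imp_nondecreasing[OF assms])
    fix y :: real assume y: "0 \<le> y" "y \<le> x"
    have "((\<lambda>x. exp (- x) - 1 + x - x\<^sup>2 / (2 * (1 + x))) has_real_derivative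
      (1 - exp (- y) - (2 * y * (2 * (1 + y)) - y\<^sup>2 * 2) / (2 * (1 + y))\<^sup>2)) (at y)"
      using y by (auto intro!: derivative_eq_intros simp: power2_eq_square)
    moreover have "(2 * y * (2 * (1 + y)) - y\<^sup>2 * 2) / (2 * (1 + y))\<^sup>2 \<le> y / (1 + y)"
      using y by (simp add: divide_simps) (simp add: power2_eq_square algebra_simps)
    moreover have "y / (1 + y) = 1 - 1 / (1 + y)" using y by (simp add: field_simps)
    ultimately show "\<exists>D. ((\<lambda>x. exp (- x) - 1 + x - x\<^sup>2 / (2 * (1 + x))) has_real_derivative D) (at y) \<and> 0 \<le> D"
      using e[OF y(1)] by (intro exI conjI) auto
  qed
  thus "x\<^sup>2 / (2 * (1 + x)) \<le> exp (- x) - 1 + x" by simp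
  have "exp (- x) - 1 + x \<le> 1 / (1 + x) - 1 + x" using e[OF assms] by simp
  also have "\<dots> = x\<^sup>2 / (1 + x)" using assms by (simp add: field_simps power2_eq_square)
  also have "\<dots> \<le> x\<^sup>2 / 1" using assms by (intro divide_left_mono) auto
  finally show "exp (- x) - 1 + x \<le> x\<^sup>2" by simp
qed

text \<open>Both sides are quadratic near 0 and linear at infinity. The constant is dictated by x
  \<ge> 1, where the left side is at most 2 + x: the inequality 2 + x \<le> 6 x^2 / (1 + x) amounts
  to 2 + 3x \<le> 5x^2, an equality at x = 1. This is what lets a nonnegative Laplace sum control an
  oscillating one.\<close>

lemma norm_cis_taylor_le_exp_taylor:
  fixes x :: real
  assumes "x \<ge> 0"
  shows "norm (cis x - 1 - \<i> * of_real x) \<le> 12 * (exp (- x) - 1 + x)"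
proof -
  have "norm (cis x - 1 - \<i> * of_real x) \<le> 12 * (x\<^sup>2 / (2 * (1 + x)))"
  proof (cases "x \<le> 1")
    case True
    have "x\<^sup>2 \<le> 12 * (x\<^sup>2 / 4)" by simp
    also have "\<dots> \<le> 12 * (x\<^sup>2 / (2 * (1 + x)))"
      using True assms by (intro mult_left_mono divide_left_mono) auto
    finally show ?thesis using norm_cis_taylor_le[OF assms] by simp
  next
    case False
    have "norm (cis x - 1 - \<i> * of_real x) \<le> norm (cis x - 1) + norm (\<i> * of_real x)"
      by (rule norm_triangle_ineq4)
    also have "norm (cis x - 1) \<le> 1 + 1" using norm_triangle_ineq4[of "cis x" 1] by simp
    finally have "norm (cis x - 1 - \<i> * of_real x) \<le> 2 + x" using assms by (simp add: norm_mult)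
    also have "\<dots> \<le> 12 * (x\<^sup>2 / (2 * (1 + x)))"
    proof -
      have "1 * x \<le> x * x" using False by (intro mult_right_mono) auto
      moreover have "(2 + x) * (1 + x) = 2 + 3 * x + x * x" by (simp add: algebra_simps)
      ultimately have "(2 + x) * (1 + x) \<le> 6 * x\<^sup>2"
        using False unfolding power2_eq_square by linarith
      hence "2 + x \<le> 6 * x\<^sup>2 / (1 + x)"
        by (subst pos_le_divide_eq) (use False in simp_all)
      also have "\<dots> = 12 * (x\<^sup>2 / (2 * (1 + x)))"
        using False by (simp add: divide_simps)
      finally show ?thesis .
    qed
    finally show ?thesis .
  qed
  also have "\<dots> \<le> 12 * (exp (- x) - 1 + x)"
    by (rule mult_left_mono[OF exp_taylor_bounds(1)[OF assms]]) simp
  finally show ?thesis .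
qed

section \<open>Boundary values and moments by dominated limits of series\<close>

lemma eventually_prod_at_topI:
  assumes "eventually (\<lambda>t. \<forall>k::nat. P k t) F"
  shows "eventually (\<lambda>(k, t). P k t) (at_top \<times>\<^sub>F F)"
  unfolding eventually_prod_filter
  by (rule exI[of _ "\<lambda>_. True"], rule exI[of _ "\<lambda>t. \<forall>k. P k t"]) (use assms in auto)

text \<open>Absolute summability allows the termwise limit along the radius to \<open>z\<close>,
  while continuity of \<open>F\<close> gives the limit of the sums. It extends the binomial and
  logarithmic series from the open disc to the points of the circle other than 1.\<close>

lemma power_series_boundary:
  fixes F :: "complex \<Rightarrow> complex" and a :: "nat \<Rightarrow> real"
  assumes a: "summable (\<lambda>k. \<bar>a k\<bar>)"
    and F: "\<And>z. norm z < 1 \<Longrightarrow> (\<lambda>k. of_real (a k) * z ^ k) sums F z"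
    and z: "norm z = 1" and cont: "isCont F z"
  shows "(\<lambda>k. of_real (a k) * z ^ k) sums F z"
proof -
  let ?f = "\<lambda>k r. of_real (a k) * (of_real r * z) ^ k"
  have lim1: "((\<lambda>r::real. \<Sum>k. ?f k r) \<longlongrightarrow> (\<Sum>k. of_real (a k) * z ^ k)) (at_left 1)"
  proof (rule tannerys_theorem[where M = "\<lambda>k. \<bar>a k\<bar>", THEN conjunct2, THEN conjunct2])
    show "((\<lambda>r. ?f k r) \<longlongrightarrow> of_real (a k) * z ^ k) (at_left 1)" for k
      by (auto intro!: tendsto_eq_intros)
    have "eventually (\<lambda>r::real. r \<in> {0<..<1}) (at_left 1)"
      by (rule eventually_at_left_real) simp
    hence "eventually (\<lambda>r. \<forall>k. norm (?f k r) \<le> \<bar>a k\<bar>) (at_left 1)"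
      by eventually_elim (auto simp: norm_mult norm_power z intro!: mult_left_le power_le_one)
    thus "eventually (\<lambda>(k, r). norm (?f k r) \<le> \<bar>a k\<bar>) (at_top \<times>\<^sub>F at_left 1)"
      by (rule eventually_prod_at_topI)
  qed (use a in auto)
  have lim2: "((\<lambda>r::real. F (of_real r * z)) \<longlongrightarrow> F z) (at_left 1)"
    by (rule isCont_tendsto_compose[OF cont]) (auto intro!: tendsto_eq_intros)
  have ev: "eventually (\<lambda>r::real. (\<Sum>k. ?f k r) = F (of_real r * z)) (at_left 1)"
  proof -
    have "eventually (\<lambda>r::real. r \<in> {0<..<1}) (at_left 1)"
      by (rule eventually_at_left_real) simp
    thus ?thesis
      by eventually_elim (rule sums_unique[OF F, symmetric], simp add: norm_mult z)
  qed
  have "(\<Sum>k. of_real (a k) * z ^ k) = F z"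
    by (rule tendsto_unique[OF trivial_limit_at_left_real Lim_transform_eventually[OF lim1 ev] lim2])
  moreover have "summable (\<lambda>k. of_real (a k) * z ^ k)"
    by (rule summable_norm_cancel) (simp add: norm_mult norm_power z a)
  ultimately show ?thesis by (simp add: sums_iff)
qed

text \<open>At t = 0 the exponential series has value sum a_k and right derivative minus sum k a_k,
  and A(t) = o(t) forces both to vanish. So the comparison series has no constant or linear part,
  and these sums need not be evaluated directly.\<close>

lemma exp_series_moments_zero:
  fixes a :: "nat \<Rightarrow> real"
  assumes a: "summable (\<lambda>k. real k * \<bar>a k\<bar>)"
    and A: "\<And>t. t > 0 \<Longrightarrow> (\<lambda>k. a k * exp (- (real k * t))) sums A t"
    and A0: "((\<lambda>t. A t / t) \<longlongrightarrow> 0) (at_right 0)"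
  shows "a sums 0" "(\<lambda>k. real k * a k) sums 0"
proof -
  have pos: "eventually (\<lambda>t::real. t > 0) (at_right 0)" by (simp add: eventually_at_right_less)
  have sa: "summable (\<lambda>k. \<bar>a k\<bar>)"
    by (rule summable_comparison_test'[OF a, of 1]) (auto simp: mult_le_cancel_right1)
  have ska: "summable (\<lambda>k. real k * a k)"
    by (rule summable_norm_cancel) (use a in \<open>simp add: abs_mult\<close>)
  have "((\<lambda>t. A t / t * t) \<longlongrightarrow> 0 * 0) (at_right 0)"
    by (intro tendsto_mult A0 tendsto_ident_at)
  hence At0: "(A \<longlongrightarrow> 0) (at_right 0)"
    using pos by (rule_tac Lim_transform_eventually) (auto elim!: eventually_mono)
  have "((\<lambda>t. \<Sum>k. a k * exp (- (real k * t))) \<longlongrightarrow> (\<Sum>k. a k)) (at_right 0)"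
  proof (rule tannerys_theorem[where M = "\<lambda>k. \<bar>a k\<bar>", THEN conjunct2, THEN conjunct2])
    show "((\<lambda>t. a k * exp (- (real k * t))) \<longlongrightarrow> a k) (at_right 0)" for k
      by (auto intro!: tendsto_eq_intros)
    from pos have "eventually (\<lambda>t. \<forall>k. norm (a k * exp (- (real k * t))) \<le> \<bar>a k\<bar>) (at_right 0)"
      by eventually_elim (auto simp: abs_mult intro!: mult_left_le)
    thus "eventually (\<lambda>(k, t). norm (a k * exp (- (real k * t))) \<le> \<bar>a k\<bar>) (at_top \<times>\<^sub>F at_right 0)"
      by (rule eventually_prod_at_topI)
  qed (use sa in auto)
  moreover have "eventually (\<lambda>t. A t = (\<Sum>k. a k * exp (- (real k * t)))) (at_right 0)"
    using pos by eventually_elim (rule sums_unique[OF A])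
  from Lim_transform_eventually[OF At0 this]
  have "((\<lambda>t. \<Sum>k. a k * exp (- (real k * t))) \<longlongrightarrow> 0) (at_right 0)" .
  ultimately have "(\<Sum>k. a k) = 0" by (intro tendsto_unique[OF trivial_limit_at_right_real])
  thus a0: "a sums 0" using summable_rabs_cancel[OF sa] by (simp add: sums_iff)
  \<comment> \<open>As \<open>a\<close> sums to 0, subtracting \<open>a k\<close> termwise leaves
    the total unchanged and produces difference quotients, whose limits are -k a_k and whose
    majorant is k |a_k|.\<close>
  let ?q = "\<lambda>k t. a k * ((exp (- (real k * t)) - 1) / t)"
  have q: "eventually (\<lambda>t. A t / t = (\<Sum>k. ?q k t)) (at_right 0)"
    using pos
  proof eventually_elim
    case (elim t)
    have "(\<lambda>k. (a k * exp (- (real k * t)) - a k) / t) sums ((A t - 0) / t)"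
      by (intro sums_divide sums_diff A a0 elim)
    thus ?case by (simp add: sums_iff algebra_simps diff_divide_distrib)
  qed
  have "((\<lambda>t. \<Sum>k. ?q k t) \<longlongrightarrow> (\<Sum>k. a k * (- real k))) (at_right 0)"
  proof (rule tannerys_theorem[where M = "\<lambda>k. real k * \<bar>a k\<bar>", THEN conjunct2, THEN conjunct2])
    show "((\<lambda>t. ?q k t) \<longlongrightarrow> a k * (- real k)) (at_right 0)" for k
    proof -
      have "((\<lambda>t. exp (- (real k * t))) has_real_derivative (- real k)) (at 0)"
        by (auto intro!: derivative_eq_intros)
      hence "((\<lambda>t. (exp (- (real k * t)) - 1) / t) \<longlongrightarrow> - real k) (at_right 0)"
        by (auto simp: has_field_derivative_iff intro: filterlim_mono[OF _ order_refl at_le])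
      thus ?thesis by (intro tendsto_mult tendsto_const)
    qed
    from pos have "eventually (\<lambda>t. \<forall>k. norm (?q k t) \<le> real k * \<bar>a k\<bar>) (at_right 0)"
    proof (eventually_elim, safe)
      fix t :: real and k :: nat assume t: "t > 0"
      have "\<bar>exp (- (real k * t)) - 1\<bar> \<le> real k * t"
      proof -
        have "real k * t \<ge> 0" using t by simp
        hence "exp (- (real k * t)) \<le> 1" by simp
        thus ?thesis using exp_ge_add_one_self[of "- (real k * t)"] by linarith
      qed
      hence "\<bar>(exp (- (real k * t)) - 1) / t\<bar> \<le> real k" using t by (simp add: abs_divide pos_divide_le_eq)
      hence "\<bar>a k\<bar> * \<bar>(exp (- (real k * t)) - 1) / t\<bar> \<le> \<bar>a k\<bar> * real k" by (intro mult_left_mono) auto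
      thus "norm (?q k t) \<le> real k * \<bar>a k\<bar>" by (simp add: abs_mult mult.commute)
    qed
    thus "eventually (\<lambda>(k, t). norm (?q k t) \<le> real k * \<bar>a k\<bar>) (at_top \<times>\<^sub>F at_right 0)"
      by (rule eventually_prod_at_topI)
  qed (use a in auto)
  moreover have "((\<lambda>t. \<Sum>k. ?q k t) \<longlongrightarrow> 0) (at_right 0)"
    using Lim_transform_eventually[OF A0 q] .
  ultimately have "(\<Sum>k. a k * (- real k)) = 0" by (intro tendsto_unique[OF trivial_limit_at_right_real])
  hence "(\<Sum>k. - (real k * a k)) = 0" by (simp add: mult.commute)
  thus "(\<lambda>k. real k * a k) sums 0"
    using ska by (simp add: sums_iff suminf_minus)
qed

text \<open>Replacing \<open>w\<close> by \<open>C a\<close> costs \<open>o(L)\<close>: since \<open>a\<close> is eventually positive, the error in the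
  Fourier series is dominated by the Laplace series \<open>A\<close>, whose order at \<open>0\<close> is known.\<close>
lemma chf_asymp_comparison:
  fixes w a :: "nat \<Rightarrow> real" and A L :: "real \<Rightarrow> real" and B :: "real \<Rightarrow> complex"
  assumes a: "summable (\<lambda>k. real k * \<bar>a k\<bar>)" "eventually (\<lambda>k. a k > 0) sequentially"
    and ratio: "(\<lambda>k. w k / a k) \<longlonglongrightarrow> C" and w: "\<And>k. w k \<ge> 0"
    and A: "\<And>t. t > 0 \<Longrightarrow> (\<lambda>k. a k * exp (- (real k * t))) sums A t"
    and A0: "((\<lambda>t. A t / t) \<longlongrightarrow> 0) (at_right 0)"
    and AL: "((\<lambda>t. A t / L t) \<longlongrightarrow> 1) (at_right 0)"
    and B: "\<And>t. 0 < t \<Longrightarrow> t < pi \<Longrightarrow> (\<lambda>k. of_real (a k) * cis (real k * t)) sums B t"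
    and BL: "((\<lambda>t. B t / of_real (L t)) \<longlongrightarrow> l) (at_right 0)"
    and L: "eventually (\<lambda>t. L t > 0) (at_right 0)" "((\<lambda>t. t\<^sup>2 / L t) \<longlongrightarrow> 0) (at_right 0)"
  shows "summable (\<lambda>k. real k * w k)"
    and "((\<lambda>t. (chf w t - of_real (suminf w) - \<i> * of_real (t * (\<Sum>k. real k * w k))) / of_real (L t))
          \<longlongrightarrow> of_real C * l) (at_right 0)"
proof -
  have a0: "a sums 0" "(\<lambda>k. real k * a k) sums 0"
    using exp_series_moments_zero[OF a(1) A A0] by blast+
  \<comment> \<open>\<open>h\<close> and \<open>g\<close> are the kernels e^(ix) and e^(-x) without
    their constant and linear parts; for x \<ge> 0 the norm of \<open>h x\<close> is at most
    \<open>12 * g x\<close>.\<close>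
  define h where "h = (\<lambda>x::real. cis x - 1 - \<i> * of_real x)"
  define g where "g = (\<lambda>x::real. exp (- x) - 1 + x)"
  define d where "d = (\<lambda>k. w k - C * a k)"
  have d_small: "eventually (\<lambda>k. \<bar>d k\<bar> \<le> \<epsilon> * a k \<and> a k > 0) sequentially" if "\<epsilon> > 0" for \<epsilon>
  proof -
    have "eventually (\<lambda>k. \<bar>w k / a k - C\<bar> < \<epsilon>) sequentially"
      using tendstoD[OF ratio that] by (simp add: dist_real_def)
    with a(2) show ?thesis
    proof eventually_elim
      case (elim k)
      have "d k = (w k / a k - C) * a k" using elim by (simp add: d_def field_simps)
      thus ?case using elim by (simp add: abs_mult)
    qed
  qed
  have sd: "summable (\<lambda>k. real k * \<bar>d k\<bar>)"
  proof (rule summable_comparison_test_ev[OF _ a(1)])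
    show "eventually (\<lambda>k. norm (real k * \<bar>d k\<bar>) \<le> real k * \<bar>a k\<bar>) sequentially"
      using d_small[OF zero_less_one] by eventually_elim (auto simp: abs_mult intro!: mult_left_mono)
  qed
  have w_eq: "w k = C * a k + d k" for k by (simp add: d_def)
  have ska: "summable (\<lambda>k. real k * a k)" and skd: "summable (\<lambda>k. real k * d k)"
    by (rule summable_norm_cancel, use a sd in \<open>simp add: abs_mult\<close>)+
  have sa: "summable a" using a0 by (simp add: sums_iff)
  have sd': "summable (\<lambda>k. \<bar>d k\<bar>)"
    by (rule summable_comparison_test'[OF sd, of 1]) (auto simp: mult_le_cancel_right1)
  have sw: "summable w"
    unfolding w_eq[abs_def] by (intro summable_add summable_mult sa summable_rabs_cancel[OF sd'])
  show skw: "summable (\<lambda>k. real k * w k)"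
    unfolding w_eq[abs_def] using summable_add[OF summable_mult[OF ska, of C] skd]
    by (simp add: algebra_simps)
  have sums_w: "(\<lambda>k. of_real (w k) * h (real k * t)) sums
      (chf w t - of_real (suminf w) - \<i> * of_real (t * (\<Sum>k. real k * w k)))" for t
  proof -
    have "(\<lambda>k. of_real (w k) * cis (real k * t) - of_real (w k) - \<i> * of_real (t * (real k * w k))) sums
      (chf w t - of_real (suminf w) - \<i> * of_real (t * (\<Sum>k. real k * w k)))"
      by (intro sums_diff sums_mult sums_of_real chf_sums w sw summable_sums skw)
    thus ?thesis by (simp add: h_def algebra_simps)
  qed
  \<comment> \<open>The vanishing of both moments makes \<open>B\<close> itself a sum against the
    kernel \<open>h\<close>; the same holds for \<open>A\<close> and \<open>g\<close> below.\<close>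
  have sums_B: "(\<lambda>k. of_real (a k) * h (real k * t)) sums B t" if "0 < t" "t < pi" for t
  proof -
    have "(\<lambda>k. of_real (a k) * cis (real k * t) - of_real (a k) - \<i> * of_real (t * (real k * a k))) sums
      (B t - of_real 0 - \<i> * of_real (t * 0))"
      by (intro sums_diff sums_mult sums_of_real B that a0)
    thus ?thesis by (simp add: h_def algebra_simps)
  qed
  have sums_A: "(\<lambda>k. a k * g (real k * t)) sums A t" if "0 < t" for t
  proof -
    have "(\<lambda>k. a k * exp (- (real k * t)) - a k + t * (real k * a k)) sums (A t - 0 + t * 0)"
      by (intro sums_diff sums_add sums_mult A that a0)
    thus ?thesis by (simp add: g_def algebra_simps)
  qed
  define E where "E = (\<lambda>t. chf w t - of_real (suminf w) - \<i> * of_real (t * (\<Sum>k. real k * w k)) - of_real C * B t)"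
  have sums_E: "(\<lambda>k. of_real (d k) * h (real k * t)) sums E t" if "0 < t" "t < pi" for t
  proof -
    have "(\<lambda>k. of_real (w k) * h (real k * t) - of_real C * (of_real (a k) * h (real k * t))) sums E t"
      unfolding E_def by (intro sums_diff sums_mult sums_w sums_B that)
    thus ?thesis by (simp add: d_def algebra_simps)
  qed
  have "((\<lambda>t. E t / of_real (L t)) \<longlongrightarrow> 0) (at_right 0)"
  proof (rule tendstoI)
    fix e :: real assume e: "e > 0"
    \<comment> \<open>The majorant found below tends to 12 \<epsilon> = e / 2 after division by
      L.\<close>
    define \<epsilon> where "\<epsilon> = e / 24"
    have \<epsilon>: "\<epsilon> > 0" using e by (simp add: \<epsilon>_def)
    obtain K where K: "\<And>k. k \<ge> K \<Longrightarrow> \<bar>d k\<bar> \<le> \<epsilon> * a k \<and> a k > 0"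
      using d_small[OF \<epsilon>] by (auto simp: eventually_sequentially)
    \<comment> \<open>The finitely many indices below \<open>K\<close>, where \<open>d\<close> may
      be large, cost only O(t^2) = o(L). The second summand compensates for terms
      \<open>a k * g (k * t)\<close> of the majorant that may be negative there.\<close>
    define c where "c = (\<lambda>k. (\<bar>d k\<bar> + 12 * \<epsilon> * \<bar>a k\<bar>) * (real k)\<^sup>2)"
    define M where "M = (\<Sum>k<K. c k)"
    have bound: "norm (E t) \<le> 12 * \<epsilon> * A t + M * t\<^sup>2" if t: "0 < t" "t < pi" for t
    proof (rule norm_sums_le[OF sums_E[OF t]])
      have "(\<lambda>k. if k \<in> {..<K} then c k else 0) sums M"
        unfolding M_def by (rule sums_If_finite_set) simp
      thus "(\<lambda>k. 12 * \<epsilon> * (a k * g (real k * t)) + (if k \<in> {..<K} then c k else 0) * t\<^sup>2) sums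
          (12 * \<epsilon> * A t + M * t\<^sup>2)"
        by (intro sums_add sums_mult sums_A sums_mult2 t)
      fix k
      have x: "real k * t \<ge> 0" using t by simp
      have g0: "0 \<le> g (real k * t)"
        using order_trans[OF _ exp_taylor_bounds(1)[OF x]] x by (simp add: g_def)
      show "norm (of_real (d k) * h (real k * t)) \<le>
          12 * \<epsilon> * (a k * g (real k * t)) + (if k \<in> {..<K} then c k else 0) * t\<^sup>2"
      proof (cases "k < K")
        case True
        have "norm (of_real (d k) * h (real k * t)) \<le> \<bar>d k\<bar> * (real k * t)\<^sup>2"
          using norm_cis_taylor_le[OF x] by (simp add: norm_mult h_def mult_left_mono)
        moreover have "12 * \<epsilon> * (- \<bar>a k\<bar> * (real k * t)\<^sup>2) \<le> 12 * \<epsilon> * (a k * g (real k * t))"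
        proof (intro mult_left_mono)
          have "\<bar>a k\<bar> * g (real k * t) \<le> \<bar>a k\<bar> * (real k * t)\<^sup>2"
            using exp_taylor_bounds(2)[OF x] by (intro mult_left_mono) (auto simp: g_def)
          moreover have "- (\<bar>a k\<bar> * g (real k * t)) \<le> a k * g (real k * t)"
            using mult_right_mono[OF _ g0, of "- \<bar>a k\<bar>" "a k"] by simp
          ultimately show "- \<bar>a k\<bar> * (real k * t)\<^sup>2 \<le> a k * g (real k * t)" by simp
        qed (use \<epsilon> in auto)
        ultimately show ?thesis using True by (simp add: c_def algebra_simps power_mult_distrib)
      next
        case False
        have "norm (of_real (d k) * h (real k * t)) \<le> (\<epsilon> * a k) * (12 * g (real k * t))"
          unfolding norm_mult norm_of_real
          using K[of k] False norm_cis_taylor_le_exp_taylor[OF x] \<epsilon>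
          by (intro mult_mono) (auto simp: h_def g_def)
        thus ?thesis using False by (simp add: algebra_simps)
      qed
    qed
    have "((\<lambda>t. 12 * \<epsilon> * (A t / L t) + M * (t\<^sup>2 / L t)) \<longlongrightarrow> 12 * \<epsilon> * 1 + M * 0) (at_right 0)"
      by (intro tendsto_intros AL L)
    hence "eventually (\<lambda>t. 12 * \<epsilon> * (A t / L t) + M * (t\<^sup>2 / L t) < e) (at_right 0)"
      by (rule order_tendstoD) (use e in \<open>simp add: \<epsilon>_def\<close>)
    moreover have "eventually (\<lambda>t::real. t \<in> {0<..<pi}) (at_right 0)"
      by (rule eventually_at_right_real) simp
    ultimately show "eventually (\<lambda>t. dist (E t / of_real (L t)) 0 < e) (at_right 0)"
      using L(1)
    proof eventually_elim
      case (elim t)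
      have "norm (E t / of_real (L t)) = norm (E t) / L t" using elim by (simp add: norm_divide)
      also have "\<dots> \<le> (12 * \<epsilon> * A t + M * t\<^sup>2) / L t"
        using elim bound[of t] by (intro divide_right_mono) auto
      also have "\<dots> < e" using elim by (simp add: add_divide_distrib)
      finally show ?case by simp
    qed
  qed
  from tendsto_add[OF this tendsto_mult[OF tendsto_const[of "of_real C"] BL]]
  show "((\<lambda>t. (chf w t - of_real (suminf w) - \<i> * of_real (t * (\<Sum>k. real k * w k))) / of_real (L t))
          \<longlongrightarrow> of_real C * l) (at_right 0)"
    by (simp add: E_def add_divide_distrib [symmetric])
qed

section \<open>Normalisation of weights to a probability sequence\<close>

lemma chf_divide: "chf (\<lambda>k. w k / s) t = chf w t / of_real s"
  if "\<And>k. w k \<ge> 0" "summable w"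
  using sums_unique[OF sums_divide[OF chf_sums[OF that], of t "of_real s"]]
  by (simp add: chf_def)

lemma Zmn_divide: "Zmn (\<lambda>k. w k / s) m n = Zmn w m n / s ^ n"
proof -
  have "prod_list (map (\<lambda>k. w k / s) ys) = prod_list (map w ys) / s ^ length ys" for ys
    by (induction ys) (auto simp: mult_ac)
  hence "Zmn (\<lambda>k. w k / s) m n =
      (\<Sum>ys\<in>{ys. length ys = n \<and> sum_list ys = m}. prod_list (map w ys) / s ^ n)"
    unfolding Zmn_def by (intro sum.cong) auto
  thus ?thesis by (simp add: Zmn_def sum_divide_distrib)
qed

text \<open>Dividing by Phi(1) gives a probability sequence with mean \<open>nu w\<close>, to which
  \<open>local_limit\<close> applies. \<open>A\<close> and \<open>B\<close> are the comparison
  function at e^(-t) and e^(it), and \<open>L\<close> is their common order at 0. The condition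
  \<open>Re l < 0\<close> puts \<zeta> in the right half-plane, so the limiting exponential
  decays.\<close>

theorem local_limit_weights:
  fixes w a b :: "nat \<Rightarrow> real" and A L :: "real \<Rightarrow> real" and B :: "real \<Rightarrow> complex"
    and m :: "nat \<Rightarrow> nat" and C :: real and l :: complex
  defines "\<zeta> \<equiv> - (of_real (C / Phi w 1) * l)"
  assumes a: "summable (\<lambda>k. real k * \<bar>a k\<bar>)" "eventually (\<lambda>k. a k > 0) sequentially"
    and ratio: "(\<lambda>k. w k / a k) \<longlonglongrightarrow> C" "C > 0" and w: "\<And>k. w k \<ge> 0" "summable w"
    and A: "\<And>t. t > 0 \<Longrightarrow> (\<lambda>k. a k * exp (- (real k * t))) sums A t"
    and A0: "((\<lambda>t. A t / t) \<longlongrightarrow> 0) (at_right 0)"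
    and AL: "((\<lambda>t. A t / L t) \<longlongrightarrow> 1) (at_right 0)"
    and B: "\<And>t. 0 < t \<Longrightarrow> t < pi \<Longrightarrow> (\<lambda>k. of_real (a k) * cis (real k * t)) sums B t"
    and BL: "((\<lambda>t. B t / of_real (L t)) \<longlongrightarrow> l) (at_right 0)"
    and L: "eventually (\<lambda>t. L t > 0) (at_right 0)" "((\<lambda>t. t\<^sup>2 / L t) \<longlongrightarrow> 0) (at_right 0)"
      "(L \<longlongrightarrow> 0) (at_right 0)"
    and pos: "Re l < 0" "\<kappa> > 0" "\<alpha> > 0"
    and b: "filterlim b at_top sequentially" "eventually (\<lambda>n. b n \<le> real n) sequentially"
    and scale: "\<And>s. s > 0 \<Longrightarrow> (\<lambda>n. real n * L (s / b n)) \<longlonglongrightarrow> \<kappa> * s powr \<alpha>"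
    and \<delta>\<^sub>0: "\<delta>\<^sub>0 > 0"
    and dom: "eventually (\<lambda>n. \<forall>s. 1 \<le> s \<and> s \<le> \<delta>\<^sub>0 * b n \<longrightarrow> s / 2 \<le> real n * L (s / b n)) sequentially"
    and m: "(\<lambda>n. (real (m n) - nu w * real n) / b n) \<longlonglongrightarrow> 0"
  shows "Phi w 1 > 0"
    and "(\<lambda>n. b n * (Zmn w (m n) n / Phi w 1 ^ n)) \<longlonglongrightarrow>
      Re (of_real (Gamma (1 + 1/\<alpha>)) * (\<zeta> * of_real \<kappa>) powr (- 1 / of_real \<alpha>)) / pi"
proof -
  define S where "S = Phi w 1"
  have S: "S = suminf w" by (simp add: S_def Phi_def)
  have "eventually (\<lambda>k. w k / a k > 0) sequentially"
    using order_tendstoD(1)[OF ratio] .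
  with a(2) have "eventually (\<lambda>k. w k > 0) sequentially"
    by eventually_elim (auto simp: zero_less_divide_iff)
  \<comment> \<open>Eventual positivity of \<open>a\<close> and of the ratio provides the two
    consecutive positive weights that keep the characteristic function away from modulus 1.\<close>
  then obtain K where K: "w K > 0" "w (Suc K) > 0"
    unfolding eventually_sequentially by (meson le_Suc_eq order_refl)
  have S_pos: "S > 0" unfolding S using w K by (intro suminf_pos2) auto
  thus "Phi w 1 > 0" by (simp add: S_def)
  define M where "M = (\<Sum>k. real k * w k)"
  have nu: "nu w = M / S" by (simp add: nu_def M_def S_def)
  have C1: "((\<lambda>t. (chf w t - of_real S - \<i> * of_real (t * M)) / of_real (L t)) \<longlongrightarrow> of_real C * l) (at_right 0)"
    unfolding S M_def by (rule chf_asymp_comparison(2)[OF a ratio(1) w(1) A A0 AL B BL L(1,2)])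
  define p where "p = (\<lambda>k. w k / S)"
  have p: "\<And>k. p k \<ge> 0" "p sums 1"
    using sums_divide[OF summable_sums[OF w(2)], of S] S_pos w by (auto simp: p_def S)
  define h where "h = (\<lambda>x::real. cis x - 1 - \<i> * of_real x)"
  have nu_nonneg: "nu w \<ge> 0"
    unfolding nu M_def using S_pos w
    by (intro divide_nonneg_pos suminf_nonneg chf_asymp_comparison(1)[OF a ratio(1) w(1) A A0 AL B BL L(1,2)]) auto
  have h0: "((\<lambda>t. h (nu w * t) / of_real (L t)) \<longlongrightarrow> 0) (at_right 0)"
  proof (rule Lim_null_comparison)
    show "eventually (\<lambda>t. norm (h (nu w * t) / of_real (L t)) \<le> (nu w)\<^sup>2 * (t\<^sup>2 / L t)) (at_right 0)"
      using L(1) eventually_at_right_less[of 0]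
    proof eventually_elim
      case (elim t)
      have "norm (h (nu w * t)) / L t \<le> (nu w * t)\<^sup>2 / L t"
        unfolding h_def using elim nu_nonneg by (intro divide_right_mono norm_cis_taylor_le) auto
      thus ?case using elim by (simp add: norm_divide power_mult_distrib)
    qed
    show "((\<lambda>t. (nu w)\<^sup>2 * (t\<^sup>2 / L t)) \<longlongrightarrow> 0) (at_right 0)"
      using tendsto_mult[OF tendsto_const L(2)] by simp
  qed
  have cis1: "((\<lambda>t. cis (- nu w * t)) \<longlongrightarrow> cis (- nu w * 0)) (at_right 0)"
    by (intro tendsto_intros tendsto_cis)
  \<comment> \<open>Centring: cis(-x) chf p - 1 = cis(-x) (chf p - 1 - ix) - cis(-x) h(x) with x = t
    times \<open>nu w\<close>. The first part carries the main term, and the second is O(t^2) =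
    o(L).\<close>
  have "((\<lambda>t. cis (- nu w * t) * ((chf w t - of_real S - \<i> * of_real (t * M)) / of_real (L t) / of_real S)
        - cis (- nu w * t) * (h (nu w * t) / of_real (L t))) \<longlongrightarrow>
      cis (- nu w * 0) * (of_real C * l / of_real S) - cis (- nu w * 0) * 0) (at_right 0)"
    using S_pos by (intro tendsto_diff tendsto_mult tendsto_divide cis1 C1 h0 tendsto_const) auto
  moreover have "cis (- nu w * 0) * (of_real C * l / of_real S) - cis (- nu w * 0) * 0 = - \<zeta>"
    by (simp add: \<zeta>_def S_def)
  moreover have "cis (- nu w * t) * ((chf w t - of_real S - \<i> * of_real (t * M)) / of_real (L t) / of_real S)
        - cis (- nu w * t) * (h (nu w * t) / of_real (L t)) = (cis (- nu w * t) * chf p t - 1) / of_real (L t)" for t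
  proof -
    have "cis (- nu w * t) * (chf w t - of_real S - \<i> * of_real (t * M)) / of_real S - cis (- nu w * t) * h (nu w * t) =
       cis (- nu w * t) * ((chf w t - of_real S - \<i> * of_real (t * M)) / of_real S + 1 + \<i> * of_real (nu w * t))
       - cis (- nu w * t) * cis (nu w * t)"
      by (simp add: h_def algebra_simps)
    also have "(chf w t - of_real S - \<i> * of_real (t * M)) / of_real S + 1 + \<i> * of_real (nu w * t) = chf p t"
      unfolding p_def chf_divide[OF w] using S_pos by (simp add: nu field_simps)
    also have "cis (- nu w * t) * cis (nu w * t) = 1" by (simp add: cis_mult)
    finally have "(cis (- nu w * t) * (chf w t - of_real S - \<i> * of_real (t * M)) / of_real S - cis (- nu w * t) * h (nu w * t)) / of_real (L t)
       = (cis (- nu w * t) * chf p t - 1) / of_real (L t)" by simp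
    moreover have "c * (X / y / z) - c * (H / y) = (c * X / z - c * H) / y" for c X H y z :: complex
      by (simp add: diff_divide_distrib mult.commute)
    ultimately show ?thesis by simp
  qed
  ultimately have lim: "((\<lambda>t. (cis (- nu w * t) * chf p t - 1) / of_real (L t)) \<longlongrightarrow> - \<zeta>) (at_right 0)"
    by simp
  have "Re \<zeta> > 0"
    using pos ratio(2) S_pos by (simp add: \<zeta>_def S_def [symmetric] divide_neg_pos mult_pos_neg)
  hence "(\<lambda>n. b n * Zmn p (m n) n) \<longlonglongrightarrow>
    Re (of_real (Gamma (1 + 1/\<alpha>)) * (\<zeta> * of_real \<kappa>) powr (- 1 / of_real \<alpha>)) / pi"
    using local_limit[OF p _ _ lim L(3,1) _ pos(2,3) b scale \<delta>\<^sub>0 dom m, of K] K S_pos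
    by (simp add: p_def)
  thus "(\<lambda>n. b n * (Zmn w (m n) n / Phi w 1 ^ n)) \<longlonglongrightarrow>
      Re (of_real (Gamma (1 + 1/\<alpha>)) * (\<zeta> * of_real \<kappa>) powr (- 1 / of_real \<alpha>)) / pi"
    by (simp add: p_def Zmn_divide S_def)
qed

section \<open>The case 1 < \<alpha> < 2: comparison with (1 - z)^\<alpha>\<close>

lemma Gamma_neg_pos:
  fixes \<alpha> :: real
  assumes "1 < \<alpha>" "\<alpha> < 2"
  shows "Gamma (- \<alpha>) > 0"
proof -
  have nonint: "- \<alpha> \<notin> \<int>\<^sub>\<le>\<^sub>0" "1 - \<alpha> \<notin> \<int>\<^sub>\<le>\<^sub>0"
  proof -
    have "\<alpha> \<notin> \<int>" using assms by (auto elim!: Ints_cases)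
    thus "- \<alpha> \<notin> \<int>\<^sub>\<le>\<^sub>0" "1 - \<alpha> \<notin> \<int>\<^sub>\<le>\<^sub>0"
      using Ints_diff[OF Ints_1, of "1 - \<alpha>"] by (auto dest!: nonpos_Ints_Int)
  qed
  \<comment> \<open>Two steps of the functional equation lead to a positive argument; the factors 1
    - \<alpha> and -\<alpha> are both negative.\<close>
  have "Gamma (2 - \<alpha>) = (1 - \<alpha>) * Gamma (1 - \<alpha>)"
    using Gamma_plus1[OF nonint(2)] by (simp add: algebra_simps)
  also have "Gamma (1 - \<alpha>) = (- \<alpha>) * Gamma (- \<alpha>)"
    using Gamma_plus1[OF nonint(1)] by (simp add: algebra_simps)
  finally have "Gamma (2 - \<alpha>) = (\<alpha> * (\<alpha> - 1)) * Gamma (- \<alpha>)" by (simp add: algebra_simps)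
  moreover have "Gamma (2 - \<alpha>) > 0" using assms by (intro Gamma_real_pos) auto
  moreover have "\<alpha> * (\<alpha> - 1) > 0" using assms by simp
  ultimately show ?thesis by (simp add: zero_less_mult_iff)
qed

text \<open>These are the coefficients of (1 - z)^\<alpha>. The limit is positive for 1 < \<alpha> <
  2 but 0 at \<alpha> = 2, where this series cannot serve for comparison.\<close>

lemma gbinomial_powr_limit:
  fixes \<alpha> :: real
  shows "(\<lambda>k. ((- 1) ^ k * (\<alpha> gchoose k)) * real k powr (\<alpha> + 1)) \<longlonglongrightarrow> inverse (Gamma (- \<alpha>))"
proof (rule Lim_transform_eventually[OF gbinomial_asymptotic[of \<alpha>]])
  show "eventually (\<lambda>k. (\<alpha> gchoose k) / ((- 1) ^ k / exp ((\<alpha> + 1) * of_real (ln (real k)))) =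
      ((- 1) ^ k * (\<alpha> gchoose k)) * real k powr (\<alpha> + 1)) sequentially"
    using eventually_gt_at_top[of 0]
  proof eventually_elim
    case (elim k)
    show ?case using elim by (cases "even k") (auto simp: powr_def)
  qed
qed

lemma summable_of_powr_limit:
  fixes a :: "nat \<Rightarrow> real"
  assumes lim: "(\<lambda>k. a k * real k powr (\<alpha> + 1)) \<longlonglongrightarrow> C" and "\<alpha> > 1"
  shows "summable (\<lambda>k. real k * \<bar>a k\<bar>)"
proof (rule summable_comparison_test_ev)
  show "summable (\<lambda>k. (\<bar>C\<bar> + 1) * real k powr (- \<alpha>))"
    using assms by (intro summable_mult) (simp add: summable_real_powr_iff)
  have "eventually (\<lambda>k. \<bar>a k * real k powr (\<alpha> + 1)\<bar> < \<bar>C\<bar> + 1) sequentially"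
    by (rule order_tendstoD(2)[OF tendsto_rabs[OF lim]]) simp
  thus "eventually (\<lambda>k. norm (real k * \<bar>a k\<bar>) \<le> (\<bar>C\<bar> + 1) * real k powr (- \<alpha>)) sequentially"
    using eventually_gt_at_top[of 0]
  proof eventually_elim
    case (elim k)
    have "real k * \<bar>a k\<bar> = \<bar>a k * real k powr (\<alpha> + 1)\<bar> * real k powr (- \<alpha>)"
      using elim by (simp add: abs_mult powr_add powr_minus field_simps)
    also have "\<dots> \<le> (\<bar>C\<bar> + 1) * real k powr (- \<alpha>)"
      using elim by (intro mult_right_mono) auto
    finally show ?case by simp
  qed
qed

lemma ratio_of_powr_limits:
  fixes a w :: "nat \<Rightarrow> real"
  assumes "(\<lambda>k. a k * real k powr \<beta>) \<longlonglongrightarrow> C" "(\<lambda>k. w k * real k powr \<beta>) \<longlonglongrightarrow> c" "C \<noteq> 0"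
  shows "(\<lambda>k. w k / a k) \<longlonglongrightarrow> c / C"
proof (rule Lim_transform_eventually[OF tendsto_divide[OF assms(2,1,3)]])
  show "eventually (\<lambda>k. w k * real k powr \<beta> / (a k * real k powr \<beta>) = w k / a k) sequentially"
    using eventually_gt_at_top[of 0] by eventually_elim simp
qed

lemma powr_limit_of_asymp_equiv:
  fixes w :: "nat \<Rightarrow> real"
  assumes "w \<sim>[at_top] (\<lambda>k. c * real k powr (- \<alpha> - 1))" "c > 0"
  shows "(\<lambda>k. w k * real k powr (\<alpha> + 1)) \<longlonglongrightarrow> c"
proof -
  have "(\<lambda>k. w k / (c * real k powr (- \<alpha> - 1))) \<longlonglongrightarrow> 1"
    by (rule asymp_equivD_strong[OF assms(1)], rule eventually_mono[OF eventually_gt_at_top[of 0]])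
       (use assms(2) in simp)
  from tendsto_mult[OF tendsto_const[of c] this]
  have "(\<lambda>k. c * (w k / (c * real k powr (- \<alpha> - 1)))) \<longlonglongrightarrow> c" by simp
  thus ?thesis
  proof (rule Lim_transform_eventually)
    show "eventually (\<lambda>k. c * (w k / (c * real k powr (- \<alpha> - 1))) = w k * real k powr (\<alpha> + 1)) sequentially"
      using eventually_gt_at_top[of 0]
    proof eventually_elim
      case (elim k)
      have "real k powr (- \<alpha> - 1) = inverse (real k powr (\<alpha> + 1))"
        by (simp flip: powr_minus)
      thus ?case using assms(2) by (simp add: field_simps)
    qed
  qed
qed

lemma one_minus_cis_div_tendsto:
  "((\<lambda>t. (1 - cis t) / of_real t) \<longlongrightarrow> - \<i>) (at_right 0)"
proof -
  have "((\<lambda>t::real. (1 - cos t) / t) \<longlongrightarrow> 0) (at_right 0)" "((\<lambda>t::real. - (sin t / t)) \<longlongrightarrow> - 1) (at_right 0)"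
    by real_asymp+
  thus ?thesis by (simp add: tendsto_complex_iff)
qed

text \<open>The real part 1 - cos t is positive, so the principal power and \<open>Ln\<close> are
  continuous at these points, as the passage to the boundary requires.\<close>

lemma one_minus_cis_notin:
  assumes "0 < t" "t < pi"
  shows "1 - cis t \<notin> \<real>\<^sub>\<le>\<^sub>0"
  using cos_monotone_0_pi[of 0 t] assms by (auto simp: complex_nonpos_Reals_iff)

lemma binomial_series_cis:
  fixes \<alpha> :: real
  assumes "summable (\<lambda>k. \<bar>(- 1) ^ k * (\<alpha> gchoose k)\<bar>)" "0 < t" "t < pi"
  shows "(\<lambda>k. of_real ((- 1) ^ k * (\<alpha> gchoose k)) * cis (real k * t)) sums ((1 - cis t) powr of_real \<alpha>)"
proof -
  have "(\<lambda>k. of_real ((- 1) ^ k * (\<alpha> gchoose k)) * cis t ^ k) sums ((1 - cis t) powr of_real \<alpha>)"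
  proof (rule power_series_boundary[OF assms(1)])
    fix z :: complex assume "norm z < 1"
    hence "(\<lambda>k. (of_real \<alpha> gchoose k) * (- z) ^ k) sums (1 + (- z)) powr of_real \<alpha>"
      by (intro gen_binomial_complex) simp
    also have "(\<lambda>k. (of_real \<alpha> gchoose k) * (- z) ^ k) = (\<lambda>k. of_real ((- 1) ^ k * (\<alpha> gchoose k)) * z ^ k)"
      by (simp add: fun_eq_iff gbinomial_pochhammer power_minus[of z] pochhammer_of_real flip: of_real_minus)
    finally show "(\<lambda>k. of_real ((- 1) ^ k * (\<alpha> gchoose k)) * z ^ k) sums ((1 - z) powr of_real \<alpha>)"
      by simp
  next
    show "isCont (\<lambda>z. (1 - z) powr of_real \<alpha>) (cis t)"
      using one_minus_cis_notin[OF assms(2,3)] by (intro continuous_intros) auto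
  qed auto
  thus ?thesis by (simp add: Complex.DeMoivre)
qed

lemma one_minus_cis_factor:
  assumes "t > 0"
  shows "1 - cis t = of_real t * ((1 - cis t) / of_real t)"
  using assms by simp

lemma neg_ii_notin_nonpos_Reals: "- \<i> \<notin> \<real>\<^sub>\<le>\<^sub>0"
  by (simp add: complex_nonpos_Reals_iff)

text \<open>The positive factor \<open>t\<close> leaves the principal power without a branch
  correction, and the remaining base tends to -i, which is off the cut.\<close>

lemma one_minus_cis_powr_tendsto:
  fixes \<alpha> :: real
  shows "((\<lambda>t. (1 - cis t) powr of_real \<alpha> / of_real (t powr \<alpha>)) \<longlongrightarrow> (- \<i>) powr of_real \<alpha>) (at_right 0)"
proof (rule Lim_transform_eventually)
  show "((\<lambda>t. ((1 - cis t) / of_real t) powr of_real \<alpha>) \<longlongrightarrow> (- \<i>) powr of_real \<alpha>) (at_right 0)"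
    by (intro tendsto_powr_complex one_minus_cis_div_tendsto tendsto_const neg_ii_notin_nonpos_Reals)
  show "eventually (\<lambda>t. ((1 - cis t) / of_real t) powr of_real \<alpha> =
      (1 - cis t) powr of_real \<alpha> / of_real (t powr \<alpha>)) (at_right 0)"
    using eventually_at_right_less[of 0]
  proof eventually_elim
    case (elim t)
    have "(1 - cis t) powr of_real \<alpha> = of_real t powr of_real \<alpha> * ((1 - cis t) / of_real t) powr of_real \<alpha>"
      using elim by (subst one_minus_cis_factor[OF elim], subst powr_times_real_left) auto
    also have "of_real t powr of_real \<alpha> = complex_of_real (t powr \<alpha>)"
      using elim by (simp add: powr_of_real)
    finally show ?case using elim by simp
  qed
qed

text \<open>This is the density at 0 of a spectrally positive stable law. The base has argument
  \<theta> = pi - pi \<alpha> / 2, the power has argument pi/2 - pi/\<alpha>, and its cosine is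
  sin(pi/\<alpha>). The reflection formula turns Gamma(1 + 1/\<alpha>) sin(pi/\<alpha>) / pi into 1
  / |Gamma(-1/\<alpha>)|.\<close>

lemma stable_density_at_0:
  fixes \<alpha> r :: real
  assumes "1 < \<alpha>" "\<alpha> < 2" "r > 0"
  shows "Re (of_real (Gamma (1 + 1/\<alpha>)) * (- (of_real r * (- \<i>) powr of_real \<alpha>)) powr (- 1 / of_real \<alpha>)) / pi =
    1 / (r powr (1/\<alpha>) * \<bar>Gamma (- 1/\<alpha>)\<bar>)"
proof -
  \<comment> \<open>The minus sign is written as a rotation by pi, chosen so that the angle lies in
    the principal range and the power just multiplies it.\<close>
  define \<theta> where "\<theta> = pi - pi * \<alpha> / 2"
  have \<theta>: "- pi < \<theta>" "\<theta> \<le> pi" using assms by (auto simp: \<theta>_def field_simps)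
  have "(- \<i>) powr of_real \<alpha> = exp (\<i> * of_real (- pi * \<alpha> / 2))"
    by (simp add: powr_def mult_ac)
  moreover have "- exp (\<i> * of_real (- pi * \<alpha> / 2)) = exp (\<i> * of_real \<theta>)"
    by (simp add: \<theta>_def algebra_simps exp_add exp_diff exp_minus inverse_eq_divide)
  ultimately have "- (of_real r * (- \<i>) powr of_real \<alpha>) = of_real r * exp (\<i> * of_real \<theta>)"
    by (metis mult_minus_right)
  hence "(- (of_real r * (- \<i>) powr of_real \<alpha>)) powr (- 1 / of_real \<alpha>) =
      of_real r powr (- 1 / of_real \<alpha>) * exp (\<i> * of_real \<theta>) powr (- 1 / of_real \<alpha>)"
    using assms by (simp only:) (rule powr_times_real_left, auto)
  also have "exp (\<i> * of_real \<theta>) powr (- 1 / of_real \<alpha>) = exp (\<i> * of_real (- \<theta> / \<alpha>))"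
    using \<theta> by (simp add: powr_def Ln_exp mult_ac)
  also have "\<dots> = cis (- \<theta> / \<alpha>)" by (simp add: cis_conv_exp)
  also have "- \<theta> / \<alpha> = pi / 2 - pi / \<alpha>" using assms by (simp add: \<theta>_def field_simps)
  also have "of_real r powr (- 1 / of_real \<alpha>) = complex_of_real (r powr (- 1 / \<alpha>))"
    using assms powr_of_real[of r "- 1 / \<alpha>"] by simp
  finally have 1: "Re (of_real (Gamma (1 + 1/\<alpha>)) * (- (of_real r * (- \<i>) powr of_real \<alpha>)) powr (- 1 / of_real \<alpha>)) =
      Gamma (1 + 1/\<alpha>) * (r powr (- 1 / \<alpha>) * sin (pi / \<alpha>))"
    by (simp add: cos_diff)
  have "complex_of_real (Gamma (- 1/\<alpha>) * Gamma (1 + 1/\<alpha>)) = of_real (pi / sin (pi * (- 1/\<alpha>)))"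
    using Gamma_reflection_complex[of "of_real (- 1/\<alpha>)"]
    by (simp add: Gamma_complex_of_real [symmetric] sin_of_real [symmetric])
  hence 2: "Gamma (- 1/\<alpha>) * Gamma (1 + 1/\<alpha>) = - (pi / sin (pi / \<alpha>))"
    unfolding of_real_eq_iff by simp
  have s: "sin (pi / \<alpha>) > 0" using assms by (intro sin_gt_zero) (auto simp: field_simps)
  have G: "Gamma (1 + 1/\<alpha>) > 0" using assms by (intro Gamma_real_pos add_pos_pos) auto
  have "\<bar>Gamma (- 1/\<alpha>)\<bar> * Gamma (1 + 1/\<alpha>) = \<bar>- (pi / sin (pi / \<alpha>))\<bar>"
    using G by (simp add: 2 [symmetric] abs_mult)
  also have "\<dots> = pi / sin (pi / \<alpha>)" using s by simp
  finally have 3: "\<bar>Gamma (- 1/\<alpha>)\<bar> = pi / (sin (pi / \<alpha>) * Gamma (1 + 1/\<alpha>))"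
    using G s by (simp add: field_simps)
  have 4: "r powr (- 1 / \<alpha>) = 1 / r powr (1 / \<alpha>)"
    using powr_minus_divide[of r "1 / \<alpha>"] by simp
  show ?thesis unfolding 1 3 4 using G s by simp
qed

text \<open>With L(t) = t^\<alpha> and \<open>b n\<close> equal to n^(1/\<alpha>), n L(s / b n) is
  exactly s^\<alpha> for n > 0. Hence \<kappa> = 1, and the domination reduces to s \<le> s^\<alpha>
  for s \<ge> 1.\<close>

theorem Zmn_limit_stable:
  fixes w :: "nat \<Rightarrow> real" and m :: "nat \<Rightarrow> nat"
  assumes w: "\<And>k. w k \<ge> 0" "summable w" and c: "c > 0" and \<alpha>: "1 < \<alpha>" "\<alpha> < 2"
    and asym: "(\<lambda>k. w k * real k powr (\<alpha> + 1)) \<longlonglongrightarrow> c"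
    and m: "(\<lambda>n. (real (m n) - nu w * real n) / real n powr (1/\<alpha>)) \<longlonglongrightarrow> 0"
  shows "Phi w 1 > 0"
    and "(\<lambda>n. real n powr (1/\<alpha>) * (Zmn w (m n) n / Phi w 1 ^ n)) \<longlonglongrightarrow>
      Phi w 1 powr (1/\<alpha>) / (c powr (1/\<alpha>) * Gamma (- \<alpha>) powr (1/\<alpha>) * \<bar>Gamma (- 1/\<alpha>)\<bar>)"
proof -
  define a where "a = (\<lambda>k. (- 1) ^ k * (\<alpha> gchoose k))"
  have G: "Gamma (- \<alpha>) > 0" using \<alpha> by (rule Gamma_neg_pos)
  have alim: "(\<lambda>k. a k * real k powr (\<alpha> + 1)) \<longlonglongrightarrow> inverse (Gamma (- \<alpha>))"
    unfolding a_def by (rule gbinomial_powr_limit)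
  have sa: "summable (\<lambda>k. real k * \<bar>a k\<bar>)" using alim \<alpha>(1) by (rule summable_of_powr_limit)
  have sa': "summable (\<lambda>k. \<bar>a k\<bar>)"
    by (rule summable_comparison_test'[OF sa, of 1]) (auto simp: mult_le_cancel_right1)
  have "eventually (\<lambda>k. a k * real k powr (\<alpha> + 1) > 0) sequentially"
    by (rule order_tendstoD(1)[OF alim]) (use G in simp)
  hence apos: "eventually (\<lambda>k. a k > 0) sequentially"
    by eventually_elim (auto simp: zero_less_mult_iff)
  have ratio: "(\<lambda>k. w k / a k) \<longlonglongrightarrow> c * Gamma (- \<alpha>)"
    using ratio_of_powr_limits[OF alim asym] G by (simp add: field_simps)
  have A: "(\<lambda>k. a k * exp (- (real k * t))) sums ((1 - exp (- t)) powr \<alpha>)" if "t > 0" for t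
  proof -
    have "(\<lambda>k. (\<alpha> gchoose k) * (- exp (- t)) ^ k) sums (1 + (- exp (- t))) powr \<alpha>"
      by (rule Generalised_Binomial_Theorem.gen_binomial_real) (use that in simp)
    also have "(\<lambda>k. (\<alpha> gchoose k) * (- exp (- t)) ^ k) = (\<lambda>k. a k * exp (- (real k * t)))"
      by (auto simp: fun_eq_iff a_def power_minus[of "exp _"] exp_of_nat_mult [symmetric])
    finally show ?thesis by simp
  qed
  have B: "(\<lambda>k. of_real (a k) * cis (real k * t)) sums ((1 - cis t) powr of_real \<alpha>)" if "0 < t" "t < pi" for t
    using binomial_series_cis[OF _ that, of \<alpha>] sa' by (simp add: a_def)
  \<comment> \<open>The real part is cos(pi \<alpha> / 2), with angle strictly between pi/2 and
    pi.\<close>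
  have re: "Re ((- \<i>) powr of_real \<alpha>) < 0"
  proof -
    have "(- \<i>) powr of_real \<alpha> = exp (\<i> * of_real (- pi * \<alpha> / 2))"
      by (simp add: powr_def mult_ac)
    also have "\<dots> = cis (- pi * \<alpha> / 2)" by (simp add: cis_conv_exp)
    finally have "Re ((- \<i>) powr of_real \<alpha>) = cos (pi * \<alpha> / 2)" by simp
    also have "\<dots> = - cos (pi - pi * \<alpha> / 2)" by (simp add: cos_diff)
    finally have "Re ((- \<i>) powr of_real \<alpha>) = - cos (pi - pi * \<alpha> / 2)" .
    moreover have "cos (pi - pi * \<alpha> / 2) > 0" using \<alpha> by (intro cos_gt_zero_pi) (auto simp: field_simps)
    ultimately show ?thesis by simp
  qed
  have resc: "real n * (s / real n powr (1/\<alpha>)) powr \<alpha> = s powr \<alpha>" if "n > 0" "s > 0" for n s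
    using that \<alpha> by (simp add: powr_divide powr_powr)
  note * = local_limit_weights[where C = "c * Gamma (- \<alpha>)" and a = a and w = w and l = "(- \<i>) powr of_real \<alpha>"
      and A = "\<lambda>t. (1 - exp (- t)) powr \<alpha>" and B = "\<lambda>t. (1 - cis t) powr of_real \<alpha>" and L = "\<lambda>t. t powr \<alpha>"
      and \<kappa> = 1 and \<alpha> = \<alpha> and b = "\<lambda>n. real n powr (1/\<alpha>)" and m = m and \<delta>\<^sub>0 = 1,
      OF sa apos ratio _ w A _ _ B one_minus_cis_powr_tendsto _ _ _ re]
  have lim0: "((\<lambda>t. (1 - exp (- t)) powr \<alpha> / t) \<longlongrightarrow> 0) (at_right 0)"
    "((\<lambda>t. (1 - exp (- t)) powr \<alpha> / t powr \<alpha>) \<longlongrightarrow> 1) (at_right 0)"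
    "((\<lambda>t. t\<^sup>2 / t powr \<alpha>) \<longlongrightarrow> 0) (at_right 0)"
    "((\<lambda>t. t powr \<alpha>) \<longlongrightarrow> 0) (at_right 0)"
    "filterlim (\<lambda>n. real n powr (1/\<alpha>)) at_top sequentially"
    using \<alpha> by real_asymp+
  have pow_le: "eventually (\<lambda>n. real n powr (1/\<alpha>) \<le> real n) sequentially"
    using eventually_ge_at_top[of 1]
  proof eventually_elim
    case (elim n)
    have "real n powr (1/\<alpha>) \<le> real n powr 1" using elim \<alpha> by (intro powr_mono) auto
    thus ?case by simp
  qed
  have scale: "(\<lambda>n. real n * (s / real n powr (1/\<alpha>)) powr \<alpha>) \<longlonglongrightarrow> 1 * s powr \<alpha>" if "s > 0" for s
    by (rule tendsto_eventually, rule eventually_mono[OF eventually_gt_at_top[of 0]])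
       (use resc that in simp)
  have dom: "eventually (\<lambda>n. \<forall>s. 1 \<le> s \<and> s \<le> 1 * real n powr (1/\<alpha>) \<longrightarrow>
      s / 2 \<le> real n * (s / real n powr (1/\<alpha>)) powr \<alpha>) sequentially"
    using eventually_gt_at_top[of 0]
  proof (eventually_elim, safe)
    fix n :: nat and s :: real assume ns: "n > 0" "1 \<le> s"
    have "s powr 1 \<le> s powr \<alpha>" using ns \<alpha> by (intro powr_mono) auto
    thus "s / 2 \<le> real n * (s / real n powr (1/\<alpha>)) powr \<alpha>" using resc[of n s] ns by simp
  qed
  have pos: "eventually (\<lambda>t::real. t powr \<alpha> > 0) (at_right 0)"
    using eventually_at_right_less[of 0] by eventually_elim simp
  have C: "c * Gamma (- \<alpha>) > 0" using c G by simp
  show S: "Phi w 1 > 0"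
    by (rule *(1)) (use lim0 pow_le scale dom pos C m \<alpha> in auto)
  have "(\<lambda>n. real n powr (1/\<alpha>) * (Zmn w (m n) n / Phi w 1 ^ n)) \<longlonglongrightarrow>
     Re (of_real (Gamma (1 + 1/\<alpha>)) * (- (of_real (c * Gamma (- \<alpha>) / Phi w 1) * (- \<i>) powr of_real \<alpha>) * of_real 1)
        powr (- 1 / of_real \<alpha>)) / pi"
    by (rule *(2)) (use lim0 pow_le scale dom pos C m \<alpha> in auto)
  also have "Re (of_real (Gamma (1 + 1/\<alpha>)) * (- (of_real (c * Gamma (- \<alpha>) / Phi w 1) * (- \<i>) powr of_real \<alpha>) * of_real 1)
        powr (- 1 / of_real \<alpha>)) / pi = 1 / ((c * Gamma (- \<alpha>) / Phi w 1) powr (1/\<alpha>) * \<bar>Gamma (- 1/\<alpha>)\<bar>)"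
    unfolding of_real_1 mult_1_right by (rule stable_density_at_0) (use \<alpha> C S in auto)
  also have "\<dots> = Phi w 1 powr (1/\<alpha>) / (c powr (1/\<alpha>) * Gamma (- \<alpha>) powr (1/\<alpha>) * \<bar>Gamma (- 1/\<alpha>)\<bar>)"
    using c G S by (simp add: powr_divide powr_mult)
  finally show "(\<lambda>n. real n powr (1/\<alpha>) * (Zmn w (m n) n / Phi w 1 ^ n)) \<longlonglongrightarrow>
      Phi w 1 powr (1/\<alpha>) / (c powr (1/\<alpha>) * Gamma (- \<alpha>) powr (1/\<alpha>) * \<bar>Gamma (- 1/\<alpha>)\<bar>)" .
qed

section \<open>The case \<alpha> = 2: coefficients of -(1 - z)^2 log(1 - z)\<close>

definition log_coeff :: "nat \<Rightarrow> real" where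
  "log_coeff k = (if k = 0 then 0 else if k = 1 then 1 else if k = 2 then - 3 / 2
     else 2 / (real k * (real k - 1) * (real k - 2)))"

lemma sums_shift:
  fixes f :: "nat \<Rightarrow> 'a :: real_normed_vector"
  assumes "f sums s"
  shows "(\<lambda>k. if k = 0 then 0 else f (k - 1)) sums s"
  using sums_Suc_iff[of "\<lambda>k. if k = 0 then 0 else f (k - 1)" s] assms by simp

text \<open>Multiplying the series of z^k / k by 1 - 2z + z^2 takes second differences of 1/k, which
  for k \<ge> 3 are 2 / (k (k-1) (k-2)). The indices up to 2 are exceptional because the series has
  no constant term.\<close>

lemma log_coeff_sums:
  fixes z :: complex
  assumes "norm z < 1"
  shows "(\<lambda>k. of_real (log_coeff k) * z ^ k) sums (- ((1 - z)\<^sup>2 * Ln (1 - z)))"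
proof -
  \<comment> \<open>At k = 0 the division by zero gives 0, which is the correct constant term of the
    logarithmic series.\<close>
  let ?f = "\<lambda>k. z ^ k / of_nat k"
  have "(\<lambda>k. - (- ((- (- z)) ^ k) / of_nat k)) sums (- Ln (1 + (- z)))"
    by (intro sums_minus Ln_series') (use assms in simp)
  hence f0: "?f sums (- Ln (1 - z))" by simp
  from sums_shift[OF sums_mult[OF f0, of z]]
  have f1: "(\<lambda>k. if k = 0 then 0 else z * ?f (k - 1)) sums (z * (- Ln (1 - z)))" .
  from sums_shift[OF sums_mult[OF f1, of z]]
  have f2: "(\<lambda>k. if k = 0 then 0 else z * (if k - 1 = 0 then 0 else z * ?f (k - 1 - 1))) sums
      (z * (z * (- Ln (1 - z))))" .
  have "(\<lambda>k. ?f k - 2 * (if k = 0 then 0 else z * ?f (k - 1))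
      + (if k = 0 then 0 else z * (if k - 1 = 0 then 0 else z * ?f (k - 1 - 1)))) sums
      (- Ln (1 - z) - 2 * (z * (- Ln (1 - z))) + z * (z * (- Ln (1 - z))))"
    by (intro sums_add sums_diff sums_mult f0 f1 f2)
  also have "- Ln (1 - z) - 2 * (z * (- Ln (1 - z))) + z * (z * (- Ln (1 - z))) = - ((1 - z)\<^sup>2 * Ln (1 - z))"
    by (simp add: power2_eq_square algebra_simps)
  also have "(\<lambda>k. ?f k - 2 * (if k = 0 then 0 else z * ?f (k - 1))
      + (if k = 0 then 0 else z * (if k - 1 = 0 then 0 else z * ?f (k - 1 - 1)))) =
      (\<lambda>k. of_real (log_coeff k) * z ^ k)"
  proof
    fix k :: nat
    consider "k = 0" | "k = 1" | "k = 2" | j where "k = j + 3"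
      by (metis One_nat_def Suc_1 add.commute add_2_eq_Suc add_Suc_right less_2_cases_iff
          less_iff_Suc_add not_less_eq numeral_3_eq_3 linorder_neqE_nat plus_1_eq_Suc)
    thus "?f k - 2 * (if k = 0 then 0 else z * ?f (k - 1))
      + (if k = 0 then 0 else z * (if k - 1 = 0 then 0 else z * ?f (k - 1 - 1))) = of_real (log_coeff k) * z ^ k"
    proof cases
      case 4
      have nz: "of_nat (j + 1) \<noteq> (0::complex)" "of_nat (j + 2) \<noteq> (0::complex)" "of_nat (j + 3) \<noteq> (0::complex)"
        by (simp_all only: of_nat_eq_0_iff)
      have "z ^ k / of_nat k - 2 * (z * (z ^ (k - 1) / of_nat (k - 1))) + z * (z * (z ^ (k - 1 - 1) / of_nat (k - 1 - 1))) =
          z ^ k * (1 / of_nat (j + 3) - 2 / of_nat (j + 2) + 1 / of_nat (j + 1))"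
        by (simp add: 4 numeral_3_eq_3 algebra_simps del: of_nat_add of_nat_Suc)
      also have "1 / of_nat (j + 3) - 2 / of_nat (j + 2) + 1 / of_nat (j + 1) =
          (2 / (of_nat (j + 3) * of_nat (j + 2) * of_nat (j + 1)) :: complex)"
        using nz by (simp add: divide_simps) (simp add: algebra_simps)
      also have "\<dots> = of_real (log_coeff k)"
        by (simp add: log_coeff_def 4)
      finally show ?thesis using 4 by simp
    qed (auto simp: log_coeff_def power2_eq_square)
  qed
  finally show ?thesis .
qed

lemma log_coeff_limit: "(\<lambda>k. log_coeff k * real k powr (2 + 1)) \<longlonglongrightarrow> 2"
proof (rule Lim_transform_eventually)
  show "(\<lambda>k. 2 / (real k * (real k - 1) * (real k - 2)) * real k powr (2 + 1)) \<longlonglongrightarrow> 2"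
    by real_asymp
  show "eventually (\<lambda>k. 2 / (real k * (real k - 1) * (real k - 2)) * real k powr (2 + 1) =
      log_coeff k * real k powr (2 + 1)) sequentially"
    using eventually_gt_at_top[of 2] by eventually_elim (simp add: log_coeff_def)
qed

lemma log_coeff_exp_sums:
  assumes "t > 0"
  shows "(\<lambda>k. log_coeff k * exp (- (real k * t))) sums (- ((1 - exp (- t))\<^sup>2 * ln (1 - exp (- t))))"
proof -
  have e1: "1 - complex_of_real (exp (- t)) = of_real (1 - exp (- t))" by simp
  have e2: "Ln (of_real (1 - exp (- t))) = of_real (ln (1 - exp (- t)))"
    using assms by (intro Ln_of_real) simp
  have e3: "of_real (log_coeff k) * (complex_of_real (exp (- t))) ^ k = of_real (log_coeff k * exp (- (real k * t)))" for k
    by (simp add: exp_of_nat_mult [symmetric] flip: of_real_power)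
  have "(\<lambda>k. of_real (log_coeff k) * (complex_of_real (exp (- t))) ^ k) sums
      (- ((1 - complex_of_real (exp (- t)))\<^sup>2 * Ln (1 - complex_of_real (exp (- t)))))"
    by (rule log_coeff_sums) (use assms in simp)
  hence "(\<lambda>k. complex_of_real (log_coeff k * exp (- (real k * t)))) sums
      of_real (- ((1 - exp (- t))\<^sup>2 * ln (1 - exp (- t))))"
    unfolding e3 e1 e2 by (simp only: of_real_minus of_real_mult of_real_power)
  thus ?thesis by (simp only: sums_of_real_iff)
qed

lemma log_coeff_cis_sums:
  assumes "summable (\<lambda>k. \<bar>log_coeff k\<bar>)" "0 < t" "t < pi"
  shows "(\<lambda>k. of_real (log_coeff k) * cis (real k * t)) sums (- ((1 - cis t)\<^sup>2 * Ln (1 - cis t)))"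
proof -
  have "(\<lambda>k. of_real (log_coeff k) * cis t ^ k) sums (- ((1 - cis t)\<^sup>2 * Ln (1 - cis t)))"
  proof (rule power_series_boundary[OF assms(1) log_coeff_sums])
    show "isCont (\<lambda>z. - ((1 - z)\<^sup>2 * Ln (1 - z))) (cis t)"
      using one_minus_cis_notin[OF assms(2,3)] by (intro continuous_intros) auto
  qed auto
  thus ?thesis by (simp add: Complex.DeMoivre)
qed

text \<open>Splitting off the positive factor gives Ln(1 - cis t) = ln t + Ln u with u tending to
  -i. After division by ln t the bounded second part disappears, and the limit is (-i)^2 =
  -1.\<close>

lemma log_cis_tendsto:
  "((\<lambda>t. - ((1 - cis t)\<^sup>2 * Ln (1 - cis t)) / of_real (t\<^sup>2 * (- ln t))) \<longlongrightarrow> - 1) (at_right 0)"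
proof (rule Lim_transform_eventually)
  have 1: "((\<lambda>t::real. 1 / ln t) \<longlongrightarrow> 0) (at_right 0)" by real_asymp
  have "((\<lambda>t. ((1 - cis t) / of_real t)\<^sup>2 * (1 + Ln ((1 - cis t) / of_real t) * of_real (1 / ln t))) \<longlongrightarrow>
      (- \<i>)\<^sup>2 * (1 + Ln (- \<i>) * of_real 0)) (at_right 0)"
    by (intro tendsto_intros one_minus_cis_div_tendsto 1 neg_ii_notin_nonpos_Reals)
  thus "((\<lambda>t. ((1 - cis t) / of_real t)\<^sup>2 * (1 + Ln ((1 - cis t) / of_real t) * of_real (1 / ln t))) \<longlongrightarrow> - 1) (at_right 0)"
    by simp
  have "eventually (\<lambda>t::real. t \<in> {0<..<1}) (at_right 0)"
    by (rule eventually_at_right_real) simp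
  thus "eventually (\<lambda>t. ((1 - cis t) / of_real t)\<^sup>2 * (1 + Ln ((1 - cis t) / of_real t) * of_real (1 / ln t)) =
      - ((1 - cis t)\<^sup>2 * Ln (1 - cis t)) / of_real (t\<^sup>2 * (- ln t))) (at_right 0)"
  proof eventually_elim
    case (elim t)
    define u where "u = (1 - cis t) / of_real t"
    have t: "t > 0" "t < 1" using elim by auto
    have "1 - cis t \<noteq> 0" using one_minus_cis_notin[of t] t pi_gt3 by auto
    hence u: "u \<noteq> 0" using t by (simp add: u_def)
    have eq: "1 - cis t = of_real t * u" using t by (simp add: u_def)
    have "Ln (1 - cis t) = of_real (ln t) + Ln u"
      unfolding eq Ln_times_of_real[OF t(1) u] by (simp add: Ln_of_real t(1))
    moreover have "complex_of_real (ln t) \<noteq> 0" using t by simp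
    moreover have "u\<^sup>2 * (1 + v * (1 / y)) = - ((x * u)\<^sup>2 * (y + v)) / (x\<^sup>2 * (- y))"
      if "y \<noteq> 0" "x \<noteq> 0" for x y v :: complex
      using that by (simp add: field_simps power_mult_distrib)
    ultimately show ?case using t(1) unfolding u_def [symmetric]
      by (simp add: eq)
  qed
qed

text \<open>With u = ln s and e^u \<ge> 1 + u, the right side is at least (1 + u) (ln b - u) = ln b
  + u (ln b - u - 1), and s \<le> b / e makes the last bracket nonnegative. So the factor s
  outweighs the loss in the logarithm.\<close>

lemma mult_ln_div_ge:
  fixes s b :: real
  assumes "1 \<le> s" "s \<le> exp (- 1) * b" "b > 0"
  shows "ln b \<le> s * ln (b / s)"
proof -
  define u where "u = ln s"
  have u: "u \<ge> 0" "s = exp u" using assms by (auto simp: u_def)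
  have "ln s \<le> ln (exp (- 1) * b)" using assms by (subst ln_le_cancel_iff) auto
  hence v: "ln b - u - 1 \<ge> 0" using assms by (simp add: u_def ln_mult)
  have "ln b \<le> ln b + u * (ln b - u - 1)" using u v by simp
  also have "\<dots> = (1 + u) * (ln b - u)" by (simp add: algebra_simps)
  also have "\<dots> \<le> exp u * (ln b - u)" using v by (intro mult_right_mono) auto
  also have "\<dots> = s * ln (b / s)" using assms u by (simp add: ln_div)
  finally show ?thesis .
qed

text \<open>The coefficients are asymptotic to 2 k^(-3), hence C = c / 2. With b^2 = n ln n, -ln(s /
  b) is asymptotic to (ln n) / 2, hence \<kappa> = 1 / 2. So \<zeta> \<kappa> = c / (4 Phi(1)), and
  Gamma(3/2) = sqrt(pi) / 2 completes the constant.\<close>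

theorem Zmn_limit_normal:
  fixes w :: "nat \<Rightarrow> real" and m :: "nat \<Rightarrow> nat"
  assumes w: "\<And>k. w k \<ge> 0" "summable w" and c: "c > 0"
    and asym: "(\<lambda>k. w k * real k powr (2 + 1)) \<longlonglongrightarrow> c"
    and m: "(\<lambda>n. (real (m n) - nu w * real n) / sqrt (real n * ln (real n))) \<longlonglongrightarrow> 0"
  shows "Phi w 1 > 0"
    and "(\<lambda>n. sqrt (real n * ln (real n)) * (Zmn w (m n) n / Phi w 1 ^ n)) \<longlonglongrightarrow> sqrt (Phi w 1 / (pi * c))"
proof -
  have sa: "summable (\<lambda>k. real k * \<bar>log_coeff k\<bar>)"
    by (rule summable_of_powr_limit[OF log_coeff_limit]) simp
  have sa': "summable (\<lambda>k. \<bar>log_coeff k\<bar>)"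
    by (rule summable_comparison_test'[OF sa, of 1]) (auto simp: mult_le_cancel_right1)
  have apos: "eventually (\<lambda>k. log_coeff k > 0) sequentially"
    using eventually_gt_at_top[of 2] by eventually_elim (auto simp: log_coeff_def)
  have ratio: "(\<lambda>k. w k / log_coeff k) \<longlonglongrightarrow> c / 2"
    by (rule ratio_of_powr_limits[OF log_coeff_limit asym]) simp
  have b: "filterlim (\<lambda>n. sqrt (real n * ln (real n))) at_top sequentially"
    "eventually (\<lambda>n. sqrt (real n * ln (real n)) \<le> real n) sequentially"
    by real_asymp+
  have lims: "((\<lambda>t::real. - ((1 - exp (- t))\<^sup>2 * ln (1 - exp (- t))) / t) \<longlongrightarrow> 0) (at_right 0)"
    "((\<lambda>t::real. - ((1 - exp (- t))\<^sup>2 * ln (1 - exp (- t))) / (t\<^sup>2 * (- ln t))) \<longlongrightarrow> 1) (at_right 0)"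
    "eventually (\<lambda>t::real. t\<^sup>2 * (- ln t) > 0) (at_right 0)"
    "((\<lambda>t::real. t\<^sup>2 / (t\<^sup>2 * (- ln t))) \<longlongrightarrow> 0) (at_right 0)"
    "((\<lambda>t::real. t\<^sup>2 * (- ln t)) \<longlongrightarrow> 0) (at_right 0)"
    by real_asymp+
  have scale: "(\<lambda>n. real n * ((s / sqrt (real n * ln (real n)))\<^sup>2 * (- ln (s / sqrt (real n * ln (real n)))))) \<longlonglongrightarrow>
      1 / 2 * s powr 2" if "s > 0" for s
  proof -
    have "(\<lambda>n. real n * ((s / sqrt (real n * ln (real n)))\<^sup>2 * (- ln (s / sqrt (real n * ln (real n)))))) \<longlonglongrightarrow>
      1 / 2 * s\<^sup>2" using that by real_asymp
    thus ?thesis using that by simp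
  qed
  \<comment> \<open>The radius e^(-1) is what \<open>mult_ln_div_ge\<close> requires. As b^2 = n ln
    n, the right side is (s / ln n) s ln(b / s), which is at least (s / ln n) ln b, and ln b \<ge>
    (ln n) / 2 once ln n \<ge> 1.\<close>
  have dom: "eventually (\<lambda>n. \<forall>s. 1 \<le> s \<and> s \<le> exp (- 1) * sqrt (real n * ln (real n)) \<longrightarrow>
      s / 2 \<le> real n * ((s / sqrt (real n * ln (real n)))\<^sup>2 * (- ln (s / sqrt (real n * ln (real n)))))) sequentially"
  proof -
    have "eventually (\<lambda>n. ln (real n) \<ge> 1) sequentially" by real_asymp
    with eventually_gt_at_top[of 1] show ?thesis
    proof (eventually_elim, safe)
      fix n :: nat and s :: real
      assume n: "n > 1" "ln (real n) \<ge> 1" and s: "1 \<le> s" "s \<le> exp (- 1) * sqrt (real n * ln (real n))"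
      define b where "b = sqrt (real n * ln (real n))"
      have b: "b > 0" "b\<^sup>2 = real n * ln (real n)" using n by (auto simp: b_def)
      have "ln b = (ln (real n) + ln (ln (real n))) / 2"
        using n by (simp add: b_def ln_sqrt ln_mult)
      moreover have "ln (ln (real n)) \<ge> 0" using n by simp
      ultimately have lnb: "ln (real n) / 2 \<le> ln b" by simp
      have "s / 2 = s / ln (real n) * (ln (real n) / 2)" using n by simp
      also have "\<dots> \<le> s / ln (real n) * (s * ln (b / s))"
        using lnb mult_ln_div_ge[of s b] s b n
        by (intro mult_left_mono) (auto simp: b_def)
      also have "\<dots> = real n * ((s / b)\<^sup>2 * (- ln (s / b)))"
        using n s b by (simp add: power_divide ln_div power2_eq_square[of s])
      finally show "s / 2 \<le> real n * ((s / sqrt (real n * ln (real n)))\<^sup>2 * (- ln (s / sqrt (real n * ln (real n)))))"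
        unfolding b_def .
    qed
  qed
  note * = local_limit_weights[where C = "c / 2" and a = log_coeff and w = w and l = "- 1"
      and A = "\<lambda>t. - ((1 - exp (- t))\<^sup>2 * ln (1 - exp (- t)))" and B = "\<lambda>t. - ((1 - cis t)\<^sup>2 * Ln (1 - cis t))"
      and L = "\<lambda>t. t\<^sup>2 * (- ln t)"
      and \<kappa> = "1 / 2" and \<alpha> = 2 and b = "\<lambda>n. sqrt (real n * ln (real n))" and m = m and \<delta>\<^sub>0 = "exp (- 1)",
      OF sa apos ratio _ w log_coeff_exp_sums lims(1,2) log_coeff_cis_sums[OF sa'] log_cis_tendsto lims(3-5)
        _ _ _ b scale _ dom m]
  show S: "Phi w 1 > 0" by (rule *(1)) (use c in auto)
  have "(\<lambda>n. sqrt (real n * ln (real n)) * (Zmn w (m n) n / Phi w 1 ^ n)) \<longlonglongrightarrow>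
     Re (of_real (Gamma (1 + 1/2)) * (- (of_real (c / 2 / Phi w 1) * (- 1)) * of_real (1 / 2))
        powr (- 1 / of_real 2)) / pi"
    by (rule *(2)) (use c in auto)
  also have "- (of_real (c / 2 / Phi w 1) * (- 1)) * of_real (1 / 2) = complex_of_real (c / (4 * Phi w 1))"
    by simp
  also have "complex_of_real (c / (4 * Phi w 1)) powr (- 1 / of_real 2) = of_real ((c / (4 * Phi w 1)) powr (- 1 / 2))"
    using powr_of_real[of "c / (4 * Phi w 1)" "- 1 / 2"] c S by simp
  also have "Re (of_real (Gamma (1 + 1/2)) * of_real ((c / (4 * Phi w 1)) powr (- 1 / 2))) / pi =
      Gamma (1 + 1/2) * (c / (4 * Phi w 1)) powr (- 1 / 2) / pi" by simp
  also have "Gamma (1 + 1/2 :: real) = sqrt pi / 2"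
  proof -
    have "(1/2 :: real) \<notin> \<int>\<^sub>\<le>\<^sub>0" by (auto elim!: nonpos_Ints_cases)
    hence "Gamma (1/2 + 1 :: real) = 1/2 * Gamma (1/2)" by (rule Gamma_plus1)
    thus ?thesis by (simp only: add.commute[of 1] Gamma_one_half_real)
  qed
  also have "(c / (4 * Phi w 1)) powr (- 1 / 2) = 2 * sqrt (Phi w 1 / c)"
  proof -
    have "(c / (4 * Phi w 1)) powr (- 1 / 2) = inverse (sqrt (c / (4 * Phi w 1)))"
      using powr_minus[of "c / (4 * Phi w 1)" "1 / 2"] c S by (simp add: powr_half_sqrt)
    also have "\<dots> = 2 * sqrt (Phi w 1 / c)"
      using c S by (simp add: real_sqrt_divide real_sqrt_mult)
    finally show ?thesis .
  qed
  also have "sqrt pi / 2 * (2 * sqrt (Phi w 1 / c)) / pi = sqrt (Phi w 1 / (pi * c))"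
    using c S by (simp add: real_sqrt_divide real_sqrt_mult field_simps)
  finally show "(\<lambda>n. sqrt (real n * ln (real n)) * (Zmn w (m n) n / Phi w 1 ^ n)) \<longlonglongrightarrow> sqrt (Phi w 1 / (pi * c))" .
qed

section \<open>Asymptotics of the partition functions\<close>

lemma asymp_equiv_of_scaled_limit:
  fixes Z b f :: "nat \<Rightarrow> real"
  assumes "(\<lambda>n. b n * (Z n / P ^ n)) \<longlonglongrightarrow> K" "K \<noteq> 0"
    and "eventually (\<lambda>n. b n > 0 \<and> f n = K * P ^ n / b n) sequentially" "P > 0"
  shows "Z \<sim>[at_top] f"
proof (rule asymp_equivI')
  have "(\<lambda>n. b n * (Z n / P ^ n) / K) \<longlonglongrightarrow> 1"
    using tendsto_divide[OF assms(1) tendsto_const assms(2)] assms(2) by simp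
  thus "(\<lambda>n. Z n / f n) \<longlonglongrightarrow> 1"
  proof (rule Lim_transform_eventually)
    show "eventually (\<lambda>n. b n * (Z n / P ^ n) / K = Z n / f n) sequentially"
      using assms(3) by eventually_elim (use assms(2,4) in \<open>simp add: field_simps\<close>)
  qed
qed

theorem theorem17p14:
  fixes w :: "nat \<Rightarrow> real" and c \<alpha> :: real
  assumes nonneg: "\<And>k. w k \<ge> 0"
    and summ: "summable w"
    and c_pos: "c > 0"
    and \<alpha>_gt: "1 < \<alpha>" and \<alpha>_le: "\<alpha> \<le> 2"
    and asym: "w \<sim>[at_top] (\<lambda>k. c * real k powr (-\<alpha> - 1))"
  shows
   "(nu w = 1 \<longrightarrow>
       (\<alpha> < 2 \<longrightarrow>
          Ztree w \<sim>[at_top] (\<lambda>n. Phi w 1 powr (1/\<alpha>) /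
              (c powr (1/\<alpha>) * Gamma (-\<alpha>) powr (1/\<alpha>) * \<bar>Gamma (-1/\<alpha>)\<bar>)
              * Phi w 1 ^ n * real n powr (-1 - 1/\<alpha>)))
     \<and> (\<alpha> = 2 \<longrightarrow>
          Ztree w \<sim>[at_top] (\<lambda>n. sqrt (Phi w 1 / (pi * c))
              * Phi w 1 ^ n * real n powr (-3/2) * ln (real n) powr (-1/2))))
    \<and> (\<forall>m :: nat \<Rightarrow> nat.
         (\<lambda>n. real (m n) - nu w * real n) \<in> o[at_top](\<lambda>n. real n powr (1/\<alpha>)) \<longrightarrow>
         (\<alpha> < 2 \<longrightarrow>
            (\<lambda>n. Zmn w (m n) n) \<sim>[at_top] (\<lambda>n. Phi w 1 powr (1/\<alpha>) /
              (c powr (1/\<alpha>) * Gamma (-\<alpha>) powr (1/\<alpha>) * \<bar>Gamma (-1/\<alpha>)\<bar>)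
              * Phi w 1 ^ n * real n powr (-1/\<alpha>)))
       \<and> (\<alpha> = 2 \<longrightarrow>
            (\<lambda>n. Zmn w (m n) n) \<sim>[at_top] (\<lambda>n. sqrt (Phi w 1 / (pi * c))
              * Phi w 1 ^ n / sqrt (real n * ln (real n)))))"
proof (intro conjI impI allI)
  have asym': "(\<lambda>k. w k * real k powr (\<alpha> + 1)) \<longlonglongrightarrow> c"
    using asym c_pos by (rule powr_limit_of_asymp_equiv)
  have stable: "Phi w 1 > 0 \<and> (\<lambda>n. real n powr (1/\<alpha>) * (Zmn w (m n) n / Phi w 1 ^ n)) \<longlonglongrightarrow>
      Phi w 1 powr (1/\<alpha>) / (c powr (1/\<alpha>) * Gamma (- \<alpha>) powr (1/\<alpha>) * \<bar>Gamma (- 1/\<alpha>)\<bar>)"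
    if "(\<lambda>n. real (m n) - nu w * real n) \<in> o(\<lambda>n. real n powr (1/\<alpha>))" "\<alpha> < 2" for m
    using Zmn_limit_stable[OF nonneg summ c_pos \<alpha>_gt that(2) asym' smalloD_tendsto[OF that(1)]] by blast
  have normal: "Phi w 1 > 0 \<and> (\<lambda>n. sqrt (real n * ln (real n)) * (Zmn w (m n) n / Phi w 1 ^ n)) \<longlonglongrightarrow>
      sqrt (Phi w 1 / (pi * c))"
    if "(\<lambda>n. real (m n) - nu w * real n) \<in> o(\<lambda>n. real n powr (1/\<alpha>))" "\<alpha> = 2" for m
  proof -
    \<comment> \<open>The allowed deviation o(n^(1/2)) is smaller than the actual scale (n ln
      n)^(1/2), so it is admissible for the limit theorem.\<close>
    have "(\<lambda>n. real (m n) - nu w * real n) \<in> o(\<lambda>n. real n powr (1/2))"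
      using that by simp
    also have "(\<lambda>n. real n powr (1/2)) \<in> O(\<lambda>n. sqrt (real n * ln (real n)))" by real_asymp
    finally have "(\<lambda>n. (real (m n) - nu w * real n) / sqrt (real n * ln (real n))) \<longlonglongrightarrow> 0"
      by (rule smalloD_tendsto)
    thus ?thesis
      using Zmn_limit_normal[OF nonneg summ c_pos, of m] asym' that(2) by simp
  qed
  \<comment> \<open>A scaled limit yields asymptotic equivalence only if it is nonzero. Since
    -1/\<alpha> lies strictly between -1 and 0, it avoids the poles, at which \<open>Gamma\<close>
    has the value 0.\<close>
  have const_nz: "Phi w 1 powr (1/\<alpha>) / (c powr (1/\<alpha>) * Gamma (- \<alpha>) powr (1/\<alpha>) * \<bar>Gamma (- 1/\<alpha>)\<bar>) \<noteq> 0"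
    if "Phi w 1 > 0" "\<alpha> < 2"
  proof -
    have "- 1/\<alpha> \<notin> \<int>\<^sub>\<le>\<^sub>0"
    proof
      assume "- 1/\<alpha> \<in> \<int>\<^sub>\<le>\<^sub>0"
      then obtain k :: int where k: "- 1/\<alpha> = of_int k" by (auto elim: nonpos_Ints_cases)
      have "- 1 < - 1/\<alpha>" "- 1/\<alpha> < 0" using \<alpha>_gt by (auto simp: field_simps)
      hence "- 1 < k" "k < 0" unfolding k by simp_all
      thus False by simp
    qed
    hence "Gamma (- 1/\<alpha>) \<noteq> 0" by (simp add: Gamma_eq_zero_iff)
    moreover have "Gamma (- \<alpha>) \<noteq> 0" using Gamma_neg_pos[OF \<alpha>_gt that(2)] by simp
    ultimately show ?thesis using that c_pos by simp
  qed
  \<comment> \<open>For trees \<open>m n = n - 1\<close>, which differs from the mean n by the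
    constant 1; the truncated subtraction at n = 0 is avoided by arguing eventually.\<close>
  have tree_m: "(\<lambda>n. real (n - 1) - nu w * real n) \<in> o(\<lambda>n. real n powr (1/\<alpha>))" if "nu w = 1"
  proof -
    have "(\<lambda>n. - 1 :: real) \<in> o(\<lambda>n. real n powr (1/\<alpha>))" using \<alpha>_gt by real_asymp
    moreover have "eventually (\<lambda>n. - 1 = real (n - 1) - nu w * real n) at_top"
      using eventually_gt_at_top[of 0] by eventually_elim (simp add: that of_nat_diff)
    ultimately show ?thesis by (subst (asm) landau_o.small.in_cong)
  qed
  \<comment> \<open>The factor 1/n between trees and sequences is absorbed into the scale.\<close>
  have tree_scale: "(\<lambda>n. (real n * b n) * (Ztree w n / Phi w 1 ^ n)) \<longlonglongrightarrow> K"
    if "(\<lambda>n. b n * (Zmn w (n - 1) n / Phi w 1 ^ n)) \<longlonglongrightarrow> K" for b :: "nat \<Rightarrow> real" and K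
    by (rule Lim_transform_eventually[OF that], rule eventually_mono[OF eventually_gt_at_top[of 0]])
       (simp add: Ztree_eq_Zmn)
  {
    assume nu: "nu w = 1" and \<alpha>: "\<alpha> < 2"
    note * = stable[OF tree_m[OF nu] \<alpha>]
    show "Ztree w \<sim>[at_top] (\<lambda>n. Phi w 1 powr (1/\<alpha>) /
              (c powr (1/\<alpha>) * Gamma (-\<alpha>) powr (1/\<alpha>) * \<bar>Gamma (-1/\<alpha>)\<bar>)
              * Phi w 1 ^ n * real n powr (-1 - 1/\<alpha>))"
    proof (rule asymp_equiv_of_scaled_limit[OF tree_scale[OF conjunct2[OF *]] const_nz])
      show "eventually (\<lambda>n. real n * real n powr (1/\<alpha>) > 0 \<and>
          Phi w 1 powr (1/\<alpha>) / (c powr (1/\<alpha>) * Gamma (-\<alpha>) powr (1/\<alpha>) * \<bar>Gamma (-1/\<alpha>)\<bar>)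
              * Phi w 1 ^ n * real n powr (-1 - 1/\<alpha>) =
          Phi w 1 powr (1/\<alpha>) / (c powr (1/\<alpha>) * Gamma (-\<alpha>) powr (1/\<alpha>) * \<bar>Gamma (-1/\<alpha>)\<bar>)
              * Phi w 1 ^ n / (real n * real n powr (1/\<alpha>))) sequentially"
        using eventually_gt_at_top[of 0]
      proof eventually_elim
        case (elim n)
        have "real n powr (-1 - 1/\<alpha>) = 1 / (real n * real n powr (1/\<alpha>))"
          using elim powr_minus_divide[of "real n" "1 + 1/\<alpha>"] by (simp add: powr_add)
        thus ?case using elim by simp
      qed
    qed (use * \<alpha> in auto)
  next
    assume nu: "nu w = 1" and \<alpha>: "\<alpha> = 2"
    note * = normal[OF tree_m[OF nu] \<alpha>]
    show "Ztree w \<sim>[at_top] (\<lambda>n. sqrt (Phi w 1 / (pi * c))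
              * Phi w 1 ^ n * real n powr (-3/2) * ln (real n) powr (-1/2))"
    proof (rule asymp_equiv_of_scaled_limit[OF tree_scale[OF conjunct2[OF *]]])
      show "eventually (\<lambda>n. real n * sqrt (real n * ln (real n)) > 0 \<and>
          sqrt (Phi w 1 / (pi * c)) * Phi w 1 ^ n * real n powr (-3/2) * ln (real n) powr (-1/2) =
          sqrt (Phi w 1 / (pi * c)) * Phi w 1 ^ n / (real n * sqrt (real n * ln (real n)))) sequentially"
        using eventually_gt_at_top[of 1]
      proof eventually_elim
        case (elim n)
        have "real n powr (-3/2) = 1 / (real n * sqrt (real n))"
          using elim powr_minus_divide[of "real n" "3/2"] powr_add[of "real n" 1 "1/2"]
          by (simp add: powr_half_sqrt)
        moreover have "ln (real n) powr (-1/2) = 1 / sqrt (ln (real n))"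
          using elim powr_minus_divide[of "ln (real n)" "1/2"] by (simp add: powr_half_sqrt)
        ultimately show ?case using elim by (simp add: real_sqrt_mult)
      qed
    qed (use * c_pos in auto)
  next
    fix m :: "nat \<Rightarrow> nat"
    assume m: "(\<lambda>n. real (m n) - nu w * real n) \<in> o(\<lambda>n. real n powr (1/\<alpha>))" and \<alpha>: "\<alpha> < 2"
    note * = stable[OF m \<alpha>]
    show "(\<lambda>n. Zmn w (m n) n) \<sim>[at_top] (\<lambda>n. Phi w 1 powr (1/\<alpha>) /
              (c powr (1/\<alpha>) * Gamma (-\<alpha>) powr (1/\<alpha>) * \<bar>Gamma (-1/\<alpha>)\<bar>)
              * Phi w 1 ^ n * real n powr (-1/\<alpha>))"
    proof (rule asymp_equiv_of_scaled_limit[OF conjunct2[OF *] const_nz])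
      show "eventually (\<lambda>n. real n powr (1/\<alpha>) > 0 \<and>
          Phi w 1 powr (1/\<alpha>) / (c powr (1/\<alpha>) * Gamma (-\<alpha>) powr (1/\<alpha>) * \<bar>Gamma (-1/\<alpha>)\<bar>)
              * Phi w 1 ^ n * real n powr (-1/\<alpha>) =
          Phi w 1 powr (1/\<alpha>) / (c powr (1/\<alpha>) * Gamma (-\<alpha>) powr (1/\<alpha>) * \<bar>Gamma (-1/\<alpha>)\<bar>)
              * Phi w 1 ^ n / real n powr (1/\<alpha>)) sequentially"
        using eventually_gt_at_top[of 0]
      proof eventually_elim
        case (elim n)
        have "real n powr (-1/\<alpha>) = 1 / real n powr (1/\<alpha>)"
          using powr_minus_divide[of "real n" "1/\<alpha>"] by simp
        thus ?case using elim by simp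
      qed
    qed (use * \<alpha> in auto)
  next
    fix m :: "nat \<Rightarrow> nat"
    assume m: "(\<lambda>n. real (m n) - nu w * real n) \<in> o(\<lambda>n. real n powr (1/\<alpha>))" and \<alpha>: "\<alpha> = 2"
    note * = normal[OF m \<alpha>]
    show "(\<lambda>n. Zmn w (m n) n) \<sim>[at_top] (\<lambda>n. sqrt (Phi w 1 / (pi * c))
              * Phi w 1 ^ n / sqrt (real n * ln (real n)))"
    proof (rule asymp_equiv_of_scaled_limit[OF conjunct2[OF *]])
      show "eventually (\<lambda>n. sqrt (real n * ln (real n)) > 0 \<and>
          sqrt (Phi w 1 / (pi * c)) * Phi w 1 ^ n / sqrt (real n * ln (real n)) =
          sqrt (Phi w 1 / (pi * c)) * Phi w 1 ^ n / sqrt (real n * ln (real n))) sequentially"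
        using eventually_gt_at_top[of 1] by eventually_elim simp
    qed (use * c_pos in auto)
  }
qed

end
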